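(* Let $M\in\mathbb{R}^{n\times n}$ be the (positive-definite) covariance matrix of an $n$-variate normal distribution, and suppose that the condition number of $M$ satisfies $\kappa(M)\leq\tilde\kappa$. Let $k\in\{1,\ldots,n\}$ and $q\ge 1$ be integers, let $S_h$ be the $q$-sample mean of the entropy of subsets of $k$ variables, and let $S_Y$ be the $q$-sample mean of log-determinants of $k\times k$ principal submatrices of $M$. Then the standard error of the mean subsystem entropy is $\hat\sigma(S_h)=\hat\sigma(S_Y)/2$, and $\hat\sigma(S_Y)$ satisfies $$\hat\sigma(S_Y)\leq\sqrt{\frac{6k(n-k)}{qn}}\,\log\tilde\kappa$$ and $$\hat\sigma(S_Y)\leq\frac12\sqrt{\frac{\min\{k,n-k\}}{q}}\,\log\tilde\kappa.$$ Furthermore, if $M$ is diagonal and $n\ge 2$, $$\hat\sigma(S_Y)\leq\frac12\sqrt{\frac{k(n-k)}{q(n-1)}}\,\log\tilde\kappa.$$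
   Context: For a positive-definite (real symmetric) $n\times n$ matrix $M$ with eigenvalues $\lambda_1(M)\geq\cdots\geq\lambda_n(M)>0$, the condition number is $\kappa(M)=\lambda_1(M)/\lambda_n(M)$. For a $k$-element index set $I\subseteq\{1,\ldots,n\}$, $M_I:=[M_{i,j}]_{i,j\in I}$ is the corresponding principal $k\times k$ submatrix of $M$; it is the covariance matrix of the subsystem of variables indexed by $I$. Let $A_1,\ldots,A_q$ be independent random matrices, each equal to $M_I$ with $I$ chosen uniformly at random among the $\binom{n}{k}$ $k$-element subsets of $\{1,\ldots,n\}$. The $q$-sample means are $$S_Y:=\frac1q\sum_{i=1}^q\log(\det A_i),\qquad S_h:=\frac1q\sum_{i=1}^q h(A_i),$$ where, for a $k\times k$ covariance matrix $A$, the differential entropy of the corresponding $k$-variate normal distribution is $h(A)=\frac12\log(\det A)+\frac k2\left(1+\log(2\pi)\right)$. The standard error $\hat\sigma(S)$ of an estimator $S$ is its standard deviation. Here $\log$ is the natural logarithm. *)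

theory Defs
  imports
    "HOL-Probability.Probability"
    "Jordan_Normal_Form.Spectral_Radius"
    "Jordan_Normal_Form.DL_Submatrix"
begin

text \<open>
  Matrices are those of the theory Jordan_Normal_Form.Matrix, with indices starting at \<open>0\<close>;
  so the variables are indexed by \<open>{..<n}\<close>. The determinant is qualified because
  HOL-Analysis has another one for matrices of type \<open>'a ^ 'n ^ 'n\<close>.
\<close>

definition positive_definite :: "nat \<Rightarrow> real mat \<Rightarrow> bool" where
  "positive_definite n M \<longleftrightarrow>
     M \<in> carrier_mat n n \<and> transpose_mat M = M \<and>
     (\<forall>v \<in> carrier_vec n. v \<noteq> 0\<^sub>v n \<longrightarrow> scalar_prod v (M *\<^sub>v v) > 0)"

text \<open>
  Meant for symmetric positive definite matrices of dimension at least \<open>1\<close>: only then is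
  the real spectrum guaranteed to be nonempty and to consist of positive numbers.
\<close>

definition condition_number :: "real mat \<Rightarrow> real" where
  "condition_number M = Max (spectrum M) / Min (spectrum M)"

definition principal_submatrix :: "real mat \<Rightarrow> nat set \<Rightarrow> real mat" where
  "principal_submatrix M I = submatrix M I I"

definition random_principal_submatrix :: "nat \<Rightarrow> nat \<Rightarrow> real mat \<Rightarrow> real mat pmf" where
  "random_principal_submatrix n k M =
     map_pmf (principal_submatrix M) (pmf_of_set {I. I \<subseteq> {..<n} \<and> card I = k})"

text \<open>
  All these laws have finite support, so a sample can be taken to be measurable with
  respect to the discrete sigma-algebra on matrices.
\<close>

definition iid_sample :: "'w measure \<Rightarrow> nat \<Rightarrow> 'a pmf \<Rightarrow> (nat \<Rightarrow> 'w \<Rightarrow> 'a) \<Rightarrow> bool" where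
  "iid_sample P q p A \<longleftrightarrow>
     prob_space P \<and>
     prob_space.indep_vars P (\<lambda>_. count_space UNIV) A {1..q} \<and>
     (\<forall>i \<in> {1..q}. distr P (count_space UNIV) (A i) = measure_pmf p)"

definition sample_mean :: "nat \<Rightarrow> ('a \<Rightarrow> real) \<Rightarrow> (nat \<Rightarrow> 'w \<Rightarrow> 'a) \<Rightarrow> 'w \<Rightarrow> real" where
  "sample_mean q f A \<omega> = (1 / real q) * (\<Sum>i = 1..q. f (A i \<omega>))"

definition log_det :: "real mat \<Rightarrow> real" where
  "log_det A = ln (Determinant.det A)"

text \<open>
  The differential entropy, in nats, of a normal distribution with covariance matrix \<open>A\<close>;
  the number of variables is the dimension of \<open>A\<close>.
\<close>

definition normal_entropy :: "real mat \<Rightarrow> real" where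
  "normal_entropy A = 1 / 2 * ln (Determinant.det A) + real (dim_row A) / 2 * (1 + ln (2 * pi))"

definition standard_error :: "'w measure \<Rightarrow> ('w \<Rightarrow> real) \<Rightarrow> real" where
  "standard_error P S = sqrt (prob_space.variance P S)"

end

theory Submission
  imports Defs
begin

text \<open>
  Adding one index to a principal submatrix multiplies its determinant by a Schur complement, which
  lies between the smallest and the largest eigenvalue of \<open>M\<close>. Hence exchanging one index changes
  the log-determinant by at most the logarithm \<open>L\<close> of the condition number. Drawing the \<open>k\<close> indices
  one after the other gives a martingale whose increments have conditional range at most \<open>L\<close>, so by
  Popoviciu's inequality the variance is at most \<open>k L\<^sup>2 / 4\<close>; passing to complements replaces \<open>k\<close> by
  \<open>min k (n - k)\<close>. The bound with \<open>6 k (n - k) / n\<close> is weaker, because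
  \<open>n min k (n - k) \<le> 2 k (n - k)\<close>. In the diagonal case the log-determinant is the sum of a sample
  without replacement, whose variance is known exactly.
\<close>

section \<open>Variance over the subsets of fixed size\<close>

text \<open>The exchange bound reaches the conditional means of the martingale through a pairing:
  index sets through \<open>x\<close> but not \<open>y\<close> and sets through \<open>y\<close> but
  not \<open>x\<close> correspond by exchanging the two elements, while sets through both cancel.
  The martingale is never formed as a process; an induction on \<open>k\<close> over finite sums of
  squares replaces it, and independence serves to divide the variance by \<open>q\<close>. The other
  obstacle is that \<open>condition_number\<close> speaks of the real spectrum, whereas determinants
  are controlled here through the quadratic form. Bounds on the form pass to a principal submatrix
  at once, by padding a vector with zeros. What has to be supplied is an eigenvalue that bounds the
  form of a symmetric matrix.\<close>

definition average :: "'a set \<Rightarrow> ('a \<Rightarrow> real) \<Rightarrow> real" where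
  "average S f = (\<Sum>x\<in>S. f x) / real (card S)"

abbreviation k_subsets :: "'a set \<Rightarrow> nat \<Rightarrow> 'a set set" where
  "k_subsets S k \<equiv> {I. I \<subseteq> S \<and> card I = k}"

text \<open>\<open>J\<close> may have any size, so that the property survives both fixing an element
  already drawn and passing to complements. Taking \<open>x = y\<close> and \<open>J = {}\<close>
  gives \<open>0 \<le> L\<close> for nonempty \<open>S\<close>.\<close>

definition swap_bounded :: "real \<Rightarrow> 'a set \<Rightarrow> ('a set \<Rightarrow> real) \<Rightarrow> bool" where
  "swap_bounded L S f \<longleftrightarrow>
     (\<forall>J \<subseteq> S. \<forall>x \<in> S - J. \<forall>y \<in> S - J. \<bar>f (insert x J) - f (insert y J)\<bar> \<le> L)"

lemma swap_boundedD:
  "swap_bounded L S f \<Longrightarrow> J \<subseteq> S \<Longrightarrow> x \<in> S - J \<Longrightarrow> y \<in> S - J \<Longrightarrow>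
     \<bar>f (insert x J) - f (insert y J)\<bar> \<le> L"
  unfolding swap_bounded_def by blast

section \<open>Means and squared deviations\<close>

lemma card_mult_average: "finite S \<Longrightarrow> real (card S) * average S f = (\<Sum>x\<in>S. f x)"
  by (cases "S = {}") (simp_all add: average_def)

lemma average_affine:
  assumes "finite S" "S \<noteq> {}"
  shows "average S (\<lambda>x. a * f x + b) = a * average S f + b"
  using assms
  by (simp add: average_def sum.distrib sum_distrib_left[symmetric] add_divide_distrib)

text \<open>The deviations from the mean sum to zero, so the cross term vanishes. With
  \<open>c\<close> the mid-range this yields Popoviciu's inequality; with \<open>c\<close> the
  overall mean it splits squares into a part within and a part between the first draws.\<close>

lemma sum_square_deviation:
  assumes "finite S"
  shows "(\<Sum>x\<in>S. (f x - c)\<^sup>2)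
    = (\<Sum>x\<in>S. (f x - average S f)\<^sup>2) + real (card S) * (average S f - c)\<^sup>2"
proof -
  let ?\<mu> = "average S f"
  have "(\<Sum>x\<in>S. (f x - c)\<^sup>2)
      = (\<Sum>x\<in>S. (f x - ?\<mu>)\<^sup>2 + 2 * (?\<mu> - c) * (f x - ?\<mu>) + (?\<mu> - c)\<^sup>2)"
    by (rule sum.cong) (auto simp: power2_eq_square algebra_simps)
  also have "\<dots> = (\<Sum>x\<in>S. (f x - ?\<mu>)\<^sup>2) + 2 * (?\<mu> - c) * (\<Sum>x\<in>S. f x - ?\<mu>)
      + real (card S) * (?\<mu> - c)\<^sup>2"
    by (simp add: sum.distrib sum_distrib_left)
  also have "(\<Sum>x\<in>S. f x - ?\<mu>) = 0"
    using card_mult_average[OF assms, of f] by (simp add: sum_subtractf)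
  finally show ?thesis by simp
qed

text \<open>All values lie within \<open>L / 2\<close> of the mid-range, and the mean minimises the
  sum of squared deviations.\<close>

lemma Popoviciu_inequality:
  assumes "finite S" and L: "\<And>x y. x \<in> S \<Longrightarrow> y \<in> S \<Longrightarrow> \<bar>g x - g y\<bar> \<le> L"
  shows "(\<Sum>x\<in>S. (g x - average S g)\<^sup>2) \<le> real (card S) * (L\<^sup>2 / 4)"
proof (cases "S = {}")
  case False
  let ?lo = "Min (g ` S)" and ?hi = "Max (g ` S)"
  define c where "c = (?lo + ?hi) / 2"
  have "?lo \<in> g ` S" "?hi \<in> g ` S"
    using assms(1) False by (auto intro!: Min_in Max_in)
  then obtain x y where xy: "x \<in> S" "?lo = g x" "y \<in> S" "?hi = g y" by blast
  have dev: "(g z - c)\<^sup>2 \<le> L\<^sup>2 / 4" if "z \<in> S" for z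
  proof -
    have "?lo \<le> g z" "g z \<le> ?hi" using assms(1) that by auto
    moreover have "?hi - ?lo \<le> L" using L[OF xy(3,1)] xy by linarith
    ultimately have "\<bar>g z - c\<bar> \<le> L / 2"
      unfolding c_def abs_le_iff by (simp add: field_simps)
    then have "\<bar>g z - c\<bar>\<^sup>2 \<le> (L / 2)\<^sup>2" by (intro power_mono) auto
    then show ?thesis by (simp add: power_divide)
  qed
  have "(\<Sum>x\<in>S. (g x - average S g)\<^sup>2) \<le> (\<Sum>x\<in>S. (g x - c)\<^sup>2)"
    using sum_square_deviation[OF assms(1), of g c] by simp
  also have "\<dots> \<le> real (card S) * (L\<^sup>2 / 4)"
    by (rule sum_bounded_above) (rule dev)
  finally show ?thesis .
qed simp

section \<open>Subsets of fixed size, split by one of their elements\<close>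

lemma finite_k_subsets: "finite S \<Longrightarrow> finite (k_subsets S k)"
  by (rule finite_subset[of _ "Pow S"]) auto

lemma k_subsets_0: "finite S \<Longrightarrow> k_subsets S 0 = {{}}"
  using finite_subset by fastforce

lemma sum_insert_k_subsets:
  assumes "finite S" "x \<in> S"
  shows "(\<Sum>J\<in>k_subsets (S - {x}) k. F (insert x J))
    = (\<Sum>I | I \<in> k_subsets S (Suc k) \<and> x \<in> I. F I)"
proof (rule sum.reindex_bij_witness[of _ "\<lambda>I. I - {x}" "insert x"])
  fix J assume "J \<in> k_subsets (S - {x}) k"
  moreover from this have "finite J" using assms finite_subset by blast
  ultimately show "insert x J \<in> {I. I \<in> k_subsets S (Suc k) \<and> x \<in> I}"
    using assms by (auto simp: card_insert_if)
next
  fix I assume "I \<in> {I. I \<in> k_subsets S (Suc k) \<and> x \<in> I}"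
  moreover from this have "finite I" using assms finite_subset by blast
  ultimately show "I - {x} \<in> k_subsets (S - {x}) k" by auto
qed auto

text \<open>Double counting of the pairs of a set and one of its elements: each \<open>I\<close>
  arises once for each of its \<open>Suc k\<close> elements. In terms of sampling, a uniform set is
  a uniform first element followed by a uniform \<open>k\<close>-subset of the rest.\<close>

lemma sum_sum_insert_k_subsets:
  fixes F :: "'a set \<Rightarrow> real"
  assumes "finite S"
  shows "(\<Sum>x\<in>S. \<Sum>J\<in>k_subsets (S - {x}) k. F (insert x J))
    = real (Suc k) * (\<Sum>I\<in>k_subsets S (Suc k). F I)"
proof -
  have "(\<Sum>x\<in>S. \<Sum>J\<in>k_subsets (S - {x}) k. F (insert x J))
      = (\<Sum>x\<in>S. \<Sum>I | I \<in> k_subsets S (Suc k) \<and> x \<in> I. F I)"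
    by (rule sum.cong[OF refl]) (rule sum_insert_k_subsets[OF assms])
  also have "\<dots> = (\<Sum>I\<in>k_subsets S (Suc k). \<Sum>x | x \<in> S \<and> x \<in> I. F I)"
    by (rule sum.swap_restrict) (use assms finite_k_subsets in auto)
  also have "\<dots> = (\<Sum>I\<in>k_subsets S (Suc k). real (Suc k) * F I)"
  proof (rule sum.cong)
    fix I assume I: "I \<in> k_subsets S (Suc k)"
    then have "{x. x \<in> S \<and> x \<in> I} = I" by auto
    then show "(\<Sum>x | x \<in> S \<and> x \<in> I. F I) = real (Suc k) * F I" using I by simp
  qed simp
  finally show ?thesis by (simp add: sum_distrib_left)
qed

text \<open>Sets containing both \<open>x\<close> and \<open>y\<close> cancel; the others are
  matched as \<open>insert x J\<close> and \<open>insert y J\<close> with \<open>J\<close> avoiding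
  both. The number of pairs is estimated by the number of terms in each sum, so that dividing by it
  bounds the difference of two averages by \<open>L\<close>.\<close>

lemma swap_bounded_sum_diff:
  assumes fin: "finite S" and L: "swap_bounded L S f" and xy: "x \<in> S" "y \<in> S"
  shows "\<bar>(\<Sum>J\<in>k_subsets (S - {x}) k. f (insert x J)) - (\<Sum>J\<in>k_subsets (S - {y}) k. f (insert y J))\<bar>
     \<le> real (card S - 1 choose k) * L"
proof (cases "x = y")
  case True
  have "0 \<le> L" using swap_boundedD[OF L, of "{}" x x] xy by auto
  then show ?thesis using True by simp
next
  case False
  define A where "A z = {I. I \<in> k_subsets S (Suc k) \<and> z \<in> I}" for z
  have finA: "finite (A z)" for z
    unfolding A_def by (rule finite_subset[OF _ finite_k_subsets[OF fin, of "Suc k"]]) auto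
  have only: "sum f (A u - A v) = (\<Sum>J\<in>k_subsets (S - {x, y}) k. f (insert u J))"
    if "u \<in> S" "v \<in> S" "u \<noteq> v" "{u, v} = {x, y}" for u v
  proof -
    have "A u - A v = {I. I \<in> k_subsets (S - {v}) (Suc k) \<and> u \<in> I}"
      unfolding A_def by auto
    moreover have "S - {v} - {u} = S - {x, y}" using that by auto
    ultimately show ?thesis
      using sum_insert_k_subsets[of "S - {v}" u f k] fin that by simp
  qed
  have split: "sum f (A u) = sum f (A u \<inter> A v) + sum f (A u - A v)" for u v
    by (rule sum.Int_Diff[OF finA])
  have "(\<Sum>J\<in>k_subsets (S - {x}) k. f (insert x J)) - (\<Sum>J\<in>k_subsets (S - {y}) k. f (insert y J))
      = sum f (A x) - sum f (A y)"
    unfolding A_def sum_insert_k_subsets[OF fin xy(1)] sum_insert_k_subsets[OF fin xy(2)] ..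
  also have "\<dots> = sum f (A x - A y) - sum f (A y - A x)"
    using split[of x y] split[of y x] by (simp add: Int_commute)
  also have "\<dots> = (\<Sum>J\<in>k_subsets (S - {x, y}) k. f (insert x J) - f (insert y J))"
    using only[of x y] only[of y x] False xy by (simp add: sum_subtractf insert_commute)
  finally have "\<bar>(\<Sum>J\<in>k_subsets (S - {x}) k. f (insert x J)) - (\<Sum>J\<in>k_subsets (S - {y}) k. f (insert y J))\<bar>
      \<le> (\<Sum>J\<in>k_subsets (S - {x, y}) k. \<bar>f (insert x J) - f (insert y J)\<bar>)"
    by (simp add: sum_abs)
  also have "\<dots> \<le> real (card (k_subsets (S - {x, y}) k)) * L"
  proof (rule sum_bounded_above)
    fix J assume "J \<in> k_subsets (S - {x, y}) k"
    then have "J \<subseteq> S" "x \<in> S - J" "y \<in> S - J" using xy by auto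
    then show "\<bar>f (insert x J) - f (insert y J)\<bar> \<le> L" by (rule swap_boundedD[OF L])
  qed
  also have "\<dots> \<le> real (card S - 1 choose k) * L"
  proof (intro mult_right_mono)
    have "card (k_subsets (S - {x, y}) k) \<le> card (k_subsets (S - {x}) k)"
      by (rule card_mono[OF finite_k_subsets]) (use fin in auto)
    also have "\<dots> = card S - 1 choose k" using n_subsets[of "S - {x}" k] fin xy by simp
    finally show "real (card (k_subsets (S - {x, y}) k)) \<le> real (card S - 1 choose k)" by simp
    show "0 \<le> L" using swap_boundedD[OF L, of "{}" x x] xy by auto
  qed
  finally show ?thesis .
qed

text \<open>
  Law of total variance, conditioning on the first of the \<open>k\<close> elements drawn without replacement:
  the conditional means \<open>\<nu> x\<close> differ by at most \<open>L\<close>, so each draw contributes at most \<open>L\<^sup>2 / 4\<close>.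
\<close>

lemma k_subsets_square_deviation_le:
  assumes "finite S" "swap_bounded L S f" "k \<le> card S"
  shows "(\<Sum>I\<in>k_subsets S k. (f I - average (k_subsets S k) f)\<^sup>2)
    \<le> real (card S choose k) * (real k * (L\<^sup>2 / 4))"
  using assms
proof (induction k arbitrary: S f)
  case 0
  then show ?case by (simp add: k_subsets_0 average_def)
next
  case (Suc k)
  note fin = \<open>finite S\<close>
  let ?m = "card S" and ?K = "k_subsets S (Suc k)"
  define c where "c = real (?m - 1 choose k)"
  define \<mu> where "\<mu> = average ?K f"
  define \<nu> where "\<nu> x = average (k_subsets (S - {x}) k) (\<lambda>J. f (insert x J))" for x
  have c: "c > 0" using Suc.prems(3) by (simp add: c_def zero_less_binomial_iff)
  have card_x: "real (card (k_subsets (S - {x}) k)) = c" if "x \<in> S" for x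
    using n_subsets[of "S - {x}" k] fin that by (simp add: c_def)
  have sum_x: "(\<Sum>J\<in>k_subsets (S - {x}) k. f (insert x J)) = c * \<nu> x" if "x \<in> S" for x
    using card_mult_average[OF finite_k_subsets[of "S - {x}" k], of "\<lambda>J. f (insert x J)"] fin card_x[OF that]
    by (simp add: \<nu>_def)
  \<comment> \<open>Pairs of a \<open>Suc k\<close>-set and one of its elements, counted in two
    ways.\<close>
  have absorb: "real (Suc k) * real (?m choose Suc k) = real ?m * c"
    using Suc_times_binomial[of k "?m - 1"] Suc.prems(3)
    unfolding c_def of_nat_mult[symmetric] by (simp del: binomial_Suc_Suc)
  have cardK: "card ?K = ?m choose Suc k" by (rule n_subsets[OF fin])
  \<comment> \<open>Tower property: the mean of the conditional means is the overall mean.\<close>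
  have "c * (\<Sum>x\<in>S. \<nu> x) = real (Suc k) * (\<Sum>I\<in>?K. f I)"
    using sum_sum_insert_k_subsets[OF fin, where F = f and k = k] sum_x by (simp add: sum_distrib_left)
  also have "(\<Sum>I\<in>?K. f I) = real (?m choose Suc k) * \<mu>"
    using card_mult_average[OF finite_k_subsets[OF fin, of "Suc k"], of f]
    unfolding \<mu>_def cardK by (rule sym)
  also have "real (Suc k) * (real (?m choose Suc k) * \<mu>) = c * (real ?m * \<mu>)"
    unfolding mult.assoc[symmetric] absorb by (simp add: mult.commute)
  finally have "(\<Sum>x\<in>S. \<nu> x) = real ?m * \<mu>" using c by simp
  then have \<mu>: "\<mu> = average S \<nu>"
    using Suc.prems(3) by (simp add: average_def)
  \<comment> \<open>After \<open>x\<close> is drawn, the rest is a draw of \<open>k\<close> elements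
    from \<open>S - {x}\<close>, and \<open>J \<mapsto> f (insert x J)\<close> is swap bounded there
    with the same \<open>L\<close>, so the induction hypothesis applies.\<close>
  have within: "(\<Sum>J\<in>k_subsets (S - {x}) k. (f (insert x J) - \<nu> x)\<^sup>2) \<le> c * (real k * (L\<^sup>2 / 4))"
    if x: "x \<in> S" for x
  proof -
    have "swap_bounded L (S - {x}) (\<lambda>J. f (insert x J))"
      unfolding swap_bounded_def
    proof (intro allI impI ballI)
      fix J y z assume J: "J \<subseteq> S - {x}" "y \<in> S - {x} - J" "z \<in> S - {x} - J"
      then show "\<bar>f (insert x (insert y J)) - f (insert x (insert z J))\<bar> \<le> L"
        using swap_boundedD[OF Suc.prems(2), of "insert x J" y z] x by (auto simp: insert_commute)
    qed
    then show ?thesis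
      using Suc.IH[of "S - {x}" "\<lambda>J. f (insert x J)"] fin x Suc.prems(3)
      by (simp add: \<nu>_def c_def)
  qed
  have "\<bar>\<nu> x - \<nu> y\<bar> \<le> L" if "x \<in> S" "y \<in> S" for x y
  proof -
    have "\<bar>c * \<nu> x - c * \<nu> y\<bar> \<le> c * L"
      using swap_bounded_sum_diff[OF fin Suc.prems(2) that, of k] sum_x that by (simp add: c_def)
    then have "c * \<bar>\<nu> x - \<nu> y\<bar> \<le> c * L"
      using c by (simp add: abs_mult flip: right_diff_distrib)
    then show ?thesis using c by simp
  qed
  then have between: "(\<Sum>x\<in>S. (\<nu> x - \<mu>)\<^sup>2) \<le> real ?m * (L\<^sup>2 / 4)"
    unfolding \<mu> by (rule Popoviciu_inequality[OF fin])
  have "real (Suc k) * (\<Sum>I\<in>?K. (f I - \<mu>)\<^sup>2)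
      = (\<Sum>x\<in>S. \<Sum>J\<in>k_subsets (S - {x}) k. (f (insert x J) - \<mu>)\<^sup>2)"
    using sum_sum_insert_k_subsets[OF fin, where F = "\<lambda>I. (f I - \<mu>)\<^sup>2" and k = k] by simp
  also have "\<dots> = (\<Sum>x\<in>S. (\<Sum>J\<in>k_subsets (S - {x}) k. (f (insert x J) - \<nu> x)\<^sup>2) + c * (\<nu> x - \<mu>)\<^sup>2)"
    by (intro sum.cong refl, subst sum_square_deviation)
       (auto simp: finite_k_subsets fin card_x \<nu>_def)
  also have "\<dots> \<le> real ?m * (c * (real k * (L\<^sup>2 / 4))) + c * (\<Sum>x\<in>S. (\<nu> x - \<mu>)\<^sup>2)"
    using sum_mono[OF within] by (simp add: sum.distrib sum_distrib_left)
  also have "\<dots> \<le> real ?m * (c * (real k * (L\<^sup>2 / 4))) + c * (real ?m * (L\<^sup>2 / 4))"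
    using between c by simp
  also have "\<dots> = (real ?m * c) * (real (Suc k) * (L\<^sup>2 / 4))"
    by (simp add: algebra_simps)
  also have "\<dots> = real (Suc k) * (real (?m choose Suc k) * (real (Suc k) * (L\<^sup>2 / 4)))"
    unfolding absorb[symmetric] by (simp add: algebra_simps)
  finally show ?case unfolding \<mu>_def by (simp del: of_nat_Suc binomial_Suc_Suc)
qed

section \<open>Passing to complements\<close>

lemma sum_k_subsets_complement:
  assumes "finite S" "k \<le> card S"
  shows "(\<Sum>I\<in>k_subsets S (card S - k). g (S - I)) = (\<Sum>I\<in>k_subsets S k. g I)"
proof (rule sum.reindex_bij_witness[of _ "\<lambda>I. S - I" "\<lambda>I. S - I"])
  fix I assume "I \<in> k_subsets S k"
  moreover from this have "finite I" using assms finite_subset by blast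
  ultimately show "S - I \<in> k_subsets S (card S - k)" by (auto simp: card_Diff_subset)
next
  fix I assume "I \<in> k_subsets S (card S - k)"
  moreover from this have "finite I" using assms finite_subset by blast
  ultimately show "S - I \<in> k_subsets S k" using assms by (auto simp: card_Diff_subset)
qed (auto simp: double_diff)

text \<open>Putting \<open>x\<close> instead of \<open>y\<close> into a set puts \<open>y\<close>
  instead of \<open>x\<close> into its complement; the common part is then \<open>S\<close> without
  \<open>J\<close>, \<open>x\<close> and \<open>y\<close>. The case \<open>x = y\<close> is separate
  because the complement contains neither, and there only \<open>0 \<le> L\<close> is at
  stake.\<close>

lemma swap_bounded_complement:
  assumes "swap_bounded L S f"
  shows "swap_bounded L S (\<lambda>I. f (S - I))"
  unfolding swap_bounded_def
proof (intro allI impI ballI)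
  fix J x y assume J: "J \<subseteq> S" "x \<in> S - J" "y \<in> S - J"
  show "\<bar>f (S - insert x J) - f (S - insert y J)\<bar> \<le> L"
  proof (cases "x = y")
    case True
    then show ?thesis using swap_boundedD[OF assms, of "{}" x x] J by auto
  next
    case False
    let ?J = "S - insert x (insert y J)"
    have "S - insert x J = insert y ?J" "S - insert y J = insert x ?J" using J False by auto
    then show ?thesis using swap_boundedD[OF assms, of ?J y x] J by auto
  qed
qed

lemma k_subsets_square_deviation_le_min:
  assumes "finite S" "swap_bounded L S f" "k \<le> card S"
  shows "(\<Sum>I\<in>k_subsets S k. (f I - average (k_subsets S k) f)\<^sup>2)
    \<le> real (card S choose k) * (real (min k (card S - k)) * (L\<^sup>2 / 4))"
proof (cases "k \<le> card S - k")
  case True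
  then show ?thesis using k_subsets_square_deviation_le[OF assms] by (simp add: min_def)
next
  case False
  let ?n = "card S"
  have "average (k_subsets S (?n - k)) (\<lambda>I. f (S - I)) = average (k_subsets S k) f"
    using sum_k_subsets_complement[OF assms(1,3), of f] n_subsets[OF assms(1)] assms(3)
    by (simp add: average_def binomial_symmetric[of k ?n])
  then have "(\<Sum>I\<in>k_subsets S k. (f I - average (k_subsets S k) f)\<^sup>2)
    = (\<Sum>I\<in>k_subsets S (?n - k). (f (S - I) - average (k_subsets S (?n - k)) (\<lambda>I. f (S - I)))\<^sup>2)"
    using sum_k_subsets_complement[OF assms(1,3), of "\<lambda>I. (f I - average (k_subsets S k) f)\<^sup>2"]
    by simp
  also have "\<dots> \<le> real (?n choose (?n - k)) * (real (?n - k) * (L\<^sup>2 / 4))"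
    by (rule k_subsets_square_deviation_le[OF assms(1) swap_bounded_complement[OF assms(2)]]) simp
  finally show ?thesis
    using False assms(3) by (simp add: min_def binomial_symmetric[of k ?n])
qed

section \<open>Sums over a sample drawn without replacement\<close>

lemma card_k_subsets_containing:
  assumes "finite S" "i \<in> S"
  shows "card {I \<in> k_subsets S (Suc k). i \<in> I} = card S - 1 choose k"
proof -
  have "card {I \<in> k_subsets S (Suc k). i \<in> I} = card (k_subsets (S - {i}) k)"
    using sum_insert_k_subsets[OF assms, where F = "\<lambda>_. 1::nat" and k = k] by simp
  then show ?thesis using n_subsets[of "S - {i}" k] assms by simp
qed

text \<open>From the sets through \<open>i\<close>, those avoiding \<open>j\<close> are subtracted.
  The difference form also covers \<open>k = 0\<close>, where
  \<open>card S - 2 choose (k - 1)\<close> with truncated subtraction would wrongly give 1.\<close>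

lemma card_k_subsets_containing_two:
  assumes "finite S" "i \<in> S" "j \<in> S" "i \<noteq> j"
  shows "real (card {I \<in> k_subsets S (Suc k). i \<in> I \<and> j \<in> I})
    = real (card S - 1 choose k) - real (card S - 2 choose k)"
proof -
  have "{I \<in> k_subsets S (Suc k). i \<in> I}
    = {I \<in> k_subsets S (Suc k). i \<in> I \<and> j \<in> I} \<union> {I \<in> k_subsets (S - {j}) (Suc k). i \<in> I}"
    using assms by auto
  moreover have "card ({I \<in> k_subsets S (Suc k). i \<in> I \<and> j \<in> I} \<union> {I \<in> k_subsets (S - {j}) (Suc k). i \<in> I})
    = card {I \<in> k_subsets S (Suc k). i \<in> I \<and> j \<in> I} + card {I \<in> k_subsets (S - {j}) (Suc k). i \<in> I}"
    by (rule card_Un_disjoint)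
       (use finite_k_subsets[OF assms(1)] finite_k_subsets[of "S - {j}"] assms(1) in auto)
  ultimately show ?thesis
    using card_k_subsets_containing[OF assms(1,2), of k]
      card_k_subsets_containing[of "S - {j}" i k] assms
    by (simp add: numeral_2_eq_2)
qed

text \<open>When the square is expanded, the product for a pair of indices is counted
  \<open>c1\<close> times on the diagonal and \<open>c1 - c2\<close> times off it. The part common
  to all pairs is a multiple of the square of the total of \<open>b\<close>, which is zero, and only
  \<open>c2\<close> times the diagonal remains.\<close>

lemma sum_k_subsets_square_of_centered:
  fixes b :: "'a \<Rightarrow> real"
  assumes fin: "finite S" and b: "(\<Sum>i\<in>S. b i) = 0"
  shows "(\<Sum>I\<in>k_subsets S (Suc k). (\<Sum>i\<in>I. b i)\<^sup>2) = real (card S - 2 choose k) * (\<Sum>i\<in>S. (b i)\<^sup>2)"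
proof -
  let ?K = "k_subsets S (Suc k)"
  define c1 c2 where "c1 = real (card S - 1 choose k)" and "c2 = real (card S - 2 choose k)"
  have "(\<Sum>i\<in>I. b i)\<^sup>2 = (\<Sum>p | p \<in> S \<times> S \<and> fst p \<in> I \<and> snd p \<in> I. b (fst p) * b (snd p))" if "I \<in> ?K" for I
  proof -
    have "{p. p \<in> S \<times> S \<and> fst p \<in> I \<and> snd p \<in> I} = I \<times> I" using that by auto
    moreover have "finite I" using that fin finite_subset by blast
    ultimately show ?thesis by (simp add: power2_eq_square sum_product sum.cartesian_product case_prod_beta)
  qed
  then have "(\<Sum>I\<in>?K. (\<Sum>i\<in>I. b i)\<^sup>2)
      = (\<Sum>I\<in>?K. \<Sum>p | p \<in> S \<times> S \<and> fst p \<in> I \<and> snd p \<in> I. b (fst p) * b (snd p))"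
    by (rule sum.cong[OF refl])
  also have "\<dots> = (\<Sum>p\<in>S \<times> S. \<Sum>I | I \<in> ?K \<and> fst p \<in> I \<and> snd p \<in> I. b (fst p) * b (snd p))"
    by (rule sum.swap_restrict) (use fin finite_k_subsets in auto)
  also have "\<dots> = (\<Sum>p\<in>S \<times> S. (c1 - c2) * (b (fst p) * b (snd p))
      + c2 * (if fst p = snd p then b (fst p) * b (snd p) else 0))"
  proof (rule sum.cong)
    fix p assume p: "p \<in> S \<times> S"
    show "(\<Sum>I | I \<in> ?K \<and> fst p \<in> I \<and> snd p \<in> I. b (fst p) * b (snd p))
      = (c1 - c2) * (b (fst p) * b (snd p)) + c2 * (if fst p = snd p then b (fst p) * b (snd p) else 0)"
    proof (cases "fst p = snd p")
      case True
      have "real (card {I \<in> ?K. fst p \<in> I}) = c1"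
        using card_k_subsets_containing[OF fin, of "fst p" k] p by (auto simp: c1_def)
      then show ?thesis using True by (simp add: left_diff_distrib)
    next
      case False
      have "real (card {I \<in> ?K. fst p \<in> I \<and> snd p \<in> I}) = c1 - c2"
        using card_k_subsets_containing_two[OF fin, of "fst p" "snd p" k] p False by (auto simp: c1_def c2_def)
      then show ?thesis using False by simp
    qed
  qed simp
  also have "\<dots> = (c1 - c2) * (\<Sum>p\<in>S \<times> S. b (fst p) * b (snd p))
      + c2 * (\<Sum>p\<in>S \<times> S. if fst p = snd p then b (fst p) * b (snd p) else 0)"
    by (simp only: sum.distrib sum_distrib_left)
  also have "(\<Sum>p\<in>S \<times> S. b (fst p) * b (snd p)) = (\<Sum>i\<in>S. b i) * (\<Sum>i\<in>S. b i)"
    unfolding sum_product sum.cartesian_product by (simp only: case_prod_unfold)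
  also have "(\<Sum>p\<in>S \<times> S. if fst p = snd p then b (fst p) * b (snd p) else 0)
      = (\<Sum>i\<in>S. \<Sum>j\<in>S. if i = j then b i * b j else 0)"
    unfolding sum.cartesian_product by (simp only: case_prod_unfold)
  also have "(\<Sum>i\<in>S. \<Sum>j\<in>S. if i = j then b i * b j else 0) = (\<Sum>i\<in>S. (b i)\<^sup>2)"
    using fin by (intro sum.cong) (auto simp: power2_eq_square)
  finally show ?thesis using b by (simp add: c2_def)
qed

text \<open>Measuring deviations from \<open>real k * average S a\<close> cannot decrease the sum of
  squares and turns the summands into centered ones. The exact formula then leaves the spread of
  \<open>a\<close> itself, to which Popoviciu's inequality applies.\<close>

lemma k_subsets_square_deviation_additive_le:
  assumes fin: "finite S" and k: "1 \<le> k" "k \<le> card S" and n: "2 \<le> card S"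
    and L: "\<And>i j. i \<in> S \<Longrightarrow> j \<in> S \<Longrightarrow> \<bar>a i - a j\<bar> \<le> L"
  shows "(\<Sum>I\<in>k_subsets S k. ((\<Sum>i\<in>I. a i) - average (k_subsets S k) (\<lambda>I. \<Sum>i\<in>I. a i))\<^sup>2)
    \<le> real (card S choose k) * (real k * real (card S - k) / real (card S - 1) * (L\<^sup>2 / 4))"
proof -
  let ?K = "k_subsets S k" and ?n = "card S"
  define b where "b i = a i - average S a" for i
  obtain k' where k': "k = Suc k'" using k by (cases k) auto
  have bS: "(\<Sum>i\<in>S. b i) = 0"
    using card_mult_average[OF fin, of a] by (simp add: b_def sum_subtractf)
  have "(\<Sum>I\<in>?K. ((\<Sum>i\<in>I. a i) - average ?K (\<lambda>I. \<Sum>i\<in>I. a i))\<^sup>2)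
      \<le> (\<Sum>I\<in>?K. ((\<Sum>i\<in>I. a i) - real k * average S a)\<^sup>2)"
    using sum_square_deviation[OF finite_k_subsets[OF fin, of k], where f = "\<lambda>I. \<Sum>i\<in>I. a i"
        and c = "real k * average S a"]
    by simp
  also have "\<dots> = (\<Sum>I\<in>?K. (\<Sum>i\<in>I. b i)\<^sup>2)"
    by (rule sum.cong) (auto simp: b_def sum_subtractf)
  also have "\<dots> = real (?n - 2 choose k') * (\<Sum>i\<in>S. (b i)\<^sup>2)"
    unfolding k' by (rule sum_k_subsets_square_of_centered[OF fin bS])
  also have "\<dots> \<le> real (?n - 2 choose k') * (real ?n * (L\<^sup>2 / 4))"
    unfolding b_def by (intro mult_left_mono Popoviciu_inequality[OF fin L]) auto
  also have "\<dots> = real (?n choose k) * (real k * real (?n - k) / real (?n - 1) * (L\<^sup>2 / 4))"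
  proof -
    \<comment> \<open>Two absorption identities, with \<open>k = Suc k'\<close> and hence
      \<open>?n - 1 - k' = ?n - k\<close>; together they account for the factor
      \<open>k (n - k) / (n - 1)\<close>.\<close>
    have "?n * ((?n - 1) * (?n - 2 choose k')) = ?n * ((?n - 1 - k') * (?n - 1 choose k'))"
      using binomial_absorb_comp[of "?n - 1" k'] by (simp add: numeral_2_eq_2)
    also have "\<dots> = (?n - k) * (?n * (?n - 1 choose k'))" using k' by simp
    also have "?n * (?n - 1 choose k') = k * (?n choose k)"
      using Suc_times_binomial[of k' "?n - 1"] n k' by (simp del: binomial_Suc_Suc)
    finally have eq: "real ?n * (real (?n - 1) * real (?n - 2 choose k'))
        = real (?n - k) * (real k * real (?n choose k))"
      unfolding of_nat_mult[symmetric] by (rule arg_cong)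
    have rearrange: "B * (N * Q) = C * (K * Y / X * Q)"
      if "N * (X * B) = Y * (K * C)" "X > 0" for N X B Y K C Q :: real
    proof -
      have "N * B = Y * (K * C) / X" using that by (simp add: eq_divide_eq mult_ac)
      then have "N * B * Q = Y * (K * C) / X * Q" by simp
      then show ?thesis by (simp add: mult_ac)
    qed
    show ?thesis by (rule rearrange[OF eq]) (use n in simp)
  qed
  finally show ?thesis .
qed

section \<open>Quadratic forms and eigenvalues\<close>

lemma scalar_prod_self_nonneg: "0 \<le> scalar_prod v (v :: real vec)"
  by (simp add: scalar_prod_def sum_nonneg)

lemma scalar_prod_self_eq_0_iff:
  "v \<in> carrier_vec n \<Longrightarrow> scalar_prod v (v :: real vec) = 0 \<longleftrightarrow> v = 0\<^sub>v n"
  by (auto simp: scalar_prod_def sum_nonneg_eq_0_iff intro!: eq_vecI)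

lemma scalar_prod_self_pos:
  "v \<in> carrier_vec n \<Longrightarrow> v \<noteq> 0\<^sub>v n \<Longrightarrow> 0 < scalar_prod v (v :: real vec)"
  using scalar_prod_self_nonneg[of v] scalar_prod_self_eq_0_iff[of v n] by linarith

lemma index_square_le_scalar_prod_self:
  "i < dim_vec v \<Longrightarrow> (v $ i)\<^sup>2 \<le> scalar_prod v (v :: real vec)"
  using member_le_sum[of i "{0..<dim_vec v}" "\<lambda>j. v $ j * v $ j"]
  by (simp add: scalar_prod_def power2_eq_square)

text \<open>Cauchy-Schwarz in each row; the constant is the squared Frobenius norm.\<close>

lemma mult_mat_vec_bounded:
  assumes A: "(A :: real mat) \<in> carrier_mat n n"
  obtains C where "0 \<le> C"
    "\<And>v. v \<in> carrier_vec n \<Longrightarrow> scalar_prod (A *\<^sub>v v) (A *\<^sub>v v) \<le> C * scalar_prod v v"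
proof
  let ?C = "\<Sum>i<n. \<Sum>j<n. (A $$ (i, j))\<^sup>2"
  show "0 \<le> ?C" by (intro sum_nonneg) auto
  fix v :: "real vec" assume v: "v \<in> carrier_vec n"
  have vv: "scalar_prod v v = (\<Sum>j<n. (v $ j)\<^sup>2)"
    using v by (auto simp: scalar_prod_def power2_eq_square atLeast0LessThan)
  have "scalar_prod (A *\<^sub>v v) (A *\<^sub>v v) = (\<Sum>i<n. ((A *\<^sub>v v) $ i)\<^sup>2)"
    using A by (auto simp: scalar_prod_def power2_eq_square atLeast0LessThan)
  also have "\<dots> = (\<Sum>i<n. (\<Sum>j<n. A $$ (i, j) * v $ j)\<^sup>2)"
    using A v by (intro sum.cong) (auto simp: scalar_prod_def atLeast0LessThan)
  also have "\<dots> \<le> (\<Sum>i<n. (\<Sum>j<n. (A $$ (i, j))\<^sup>2) * (\<Sum>j<n. (v $ j)\<^sup>2))"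
    by (intro sum_mono Cauchy_Schwarz_ineq_sum)
  also have "\<dots> = ?C * scalar_prod v v" by (simp add: vv sum_distrib_right)
  finally show "scalar_prod (A *\<^sub>v v) (A *\<^sub>v v) \<le> ?C * scalar_prod v v" .
qed

lemma scalar_prod_symmetric_mat:
  assumes A: "(A :: real mat) \<in> carrier_mat n n" and sym: "transpose_mat A = A"
    and u: "u \<in> carrier_vec n" and v: "v \<in> carrier_vec n"
  shows "scalar_prod u (A *\<^sub>v v) = scalar_prod v (A *\<^sub>v u)"
proof -
  have "scalar_prod u (A *\<^sub>v v) = scalar_prod (transpose_mat A *\<^sub>v u) v"
    using transpose_vec_mult_scalar[OF A v u] by simp
  also have "\<dots> = scalar_prod v (A *\<^sub>v u)"
    unfolding sym using A u v by (intro comm_scalar_prod) auto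
  finally show ?thesis .
qed

lemma quadratic_form_add_smult:
  assumes A: "(A :: real mat) \<in> carrier_mat n n" and sym: "transpose_mat A = A"
    and u: "u \<in> carrier_vec n" and v: "v \<in> carrier_vec n"
  shows "scalar_prod (u + t \<cdot>\<^sub>v v) (A *\<^sub>v (u + t \<cdot>\<^sub>v v))
    = scalar_prod u (A *\<^sub>v u) + 2 * t * scalar_prod u (A *\<^sub>v v) + t\<^sup>2 * scalar_prod v (A *\<^sub>v v)"
proof -
  have [simp]: "A *\<^sub>v u \<in> carrier_vec n" "A *\<^sub>v v \<in> carrier_vec n" using A u v by auto
  have "A *\<^sub>v (u + t \<cdot>\<^sub>v v) = A *\<^sub>v u + t \<cdot>\<^sub>v (A *\<^sub>v v)"
    using A u v by (simp add: mult_add_distrib_mat_vec mult_mat_vec)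
  then show ?thesis
    using u v scalar_prod_symmetric_mat[OF A sym u v]
    by (simp add: add_scalar_prod_distrib[where n = n] scalar_prod_add_distrib[where n = n]
        power2_eq_square algebra_simps)
qed

lemma nonneg_quadratic_imp_discriminant_le:
  fixes a b c :: real
  assumes "\<And>t. 0 \<le> a + 2 * t * b + t\<^sup>2 * c" "0 \<le> c"
  shows "b\<^sup>2 \<le> a * c"
proof (cases "c = 0")
  case True
  have "b = 0"
  proof (rule ccontr)
    assume "b \<noteq> 0"
    \<comment> \<open>At this \<open>t\<close> the affine function \<open>a + 2 * t * b\<close>
      takes the value -1.\<close>
    then show False using assms(1)[of "- (a + 1) / (2 * b)"] True by (simp add: field_simps)
  qed
  then show ?thesis using True by simp
next
  case False
  \<comment> \<open>The quadratic attains its minimum at \<open>t = - b / c\<close>.\<close>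
  then have "0 \<le> a - b\<^sup>2 / c"
    using assms(1)[of "- b / c"] by (simp add: power2_eq_square)
  then show ?thesis using False assms(2) by (simp add: field_simps)
qed

text \<open>From \<open>2 * x * y \<le> x\<^sup>2 + y\<^sup>2\<close> in each coordinate and the
  bound on the length of \<open>A *\<^sub>v v\<close>.\<close>

lemma quadratic_form_bounded:
  assumes A: "(A :: real mat) \<in> carrier_mat n n"
  obtains C where "0 \<le> C"
    "\<And>v. v \<in> carrier_vec n \<Longrightarrow> scalar_prod v (A *\<^sub>v v) \<le> C * scalar_prod v v"
proof -
  obtain C where C: "0 \<le> C"
    "\<And>v. v \<in> carrier_vec n \<Longrightarrow> scalar_prod (A *\<^sub>v v) (A *\<^sub>v v) \<le> C * scalar_prod v v"
    using mult_mat_vec_bounded[OF A] by blast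
  show thesis
  proof
    show "0 \<le> C + 1" using C(1) by simp
    fix v :: "real vec" assume v: "v \<in> carrier_vec n"
    have Av: "A *\<^sub>v v \<in> carrier_vec n" using A v by auto
    have "(\<Sum>i<n. 2 * (v $ i * (A *\<^sub>v v) $ i))
        \<le> (\<Sum>i<n. v $ i * v $ i + (A *\<^sub>v v) $ i * (A *\<^sub>v v) $ i)"
      by (rule sum_mono) (metis mult.assoc power2_eq_square sum_squares_bound)
    then have "2 * scalar_prod v (A *\<^sub>v v) \<le> scalar_prod v v + scalar_prod (A *\<^sub>v v) (A *\<^sub>v v)"
      using carrier_vecD[OF v] carrier_vecD[OF Av]
      by (simp only: scalar_prod_def atLeast0LessThan sum.distrib sum_distrib_left)
    also have "\<dots> \<le> 2 * ((C + 1) * scalar_prod v v)"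
      using C(2)[OF v] mult_nonneg_nonneg[OF C(1) scalar_prod_self_nonneg[of v]]
        scalar_prod_self_nonneg[of v] by (simp add: algebra_simps)
    finally show "scalar_prod v (A *\<^sub>v v) \<le> (C + 1) * scalar_prod v v" by simp
  qed
qed

text \<open>
  This takes the place of compactness of the sphere: if \<open>\<mu>\<close> is the supremum of the Rayleigh quotient
  of \<open>M\<close>, then \<open>\<mu> I - M\<close> is positive semidefinite but not coercive, hence singular.
\<close>

lemma psd_invertible_coercive:
  assumes N: "(N :: real mat) \<in> carrier_mat n n" and sym: "transpose_mat N = N"
    and psd: "\<And>v. v \<in> carrier_vec n \<Longrightarrow> 0 \<le> scalar_prod v (N *\<^sub>v v)"
    and det: "Determinant.det N \<noteq> 0"
  obtains c where "c > 0"
    "\<And>v. v \<in> carrier_vec n \<Longrightarrow> c * scalar_prod v v \<le> scalar_prod v (N *\<^sub>v v)"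
proof -
  obtain C where C: "0 \<le> C"
    "\<And>v. v \<in> carrier_vec n \<Longrightarrow> scalar_prod v (N *\<^sub>v v) \<le> C * scalar_prod v v"
    using quadratic_form_bounded[OF N] by blast
  obtain B where B: "B \<in> carrier_mat n n" "B * N = 1\<^sub>m n"
    using det_non_zero_imp_unit[OF N det] by (auto simp: Units_def ring_mat_simps)
  obtain D where D: "0 \<le> D"
    "\<And>v. v \<in> carrier_vec n \<Longrightarrow> scalar_prod (B *\<^sub>v v) (B *\<^sub>v v) \<le> D * scalar_prod v v"
    using mult_mat_vec_bounded[OF B(1)] by blast
  show thesis
  proof
    \<comment> \<open>With \<open>w\<close> the image of \<open>v\<close> under \<open>N\<close>,
      the squared length of \<open>v\<close> is at most \<open>D\<close> times that of
      \<open>w\<close>, which is at most \<open>C\<close> times the form at \<open>v\<close>. Either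
      constant may be zero, hence the added ones.\<close>
    show "1 / ((D + 1) * (C + 1)) > 0" using C(1) D(1) by simp
    fix v :: "real vec" assume v: "v \<in> carrier_vec n"
    define w where "w = N *\<^sub>v v"
    let ?q = "scalar_prod v (N *\<^sub>v v)"
    have w: "w \<in> carrier_vec n" using N v by (auto simp: w_def)
    \<comment> \<open>Cauchy-Schwarz for the form of \<open>N\<close> at \<open>v\<close> and
      \<open>w\<close>. The left side is the square of \<open>scalar_prod w w\<close>; bounding the
      last factor by \<open>C * scalar_prod w w\<close> and cancelling shows that the form at
      \<open>v\<close> controls the length of \<open>w\<close>.\<close>
    have "(scalar_prod v (N *\<^sub>v w))\<^sup>2 \<le> ?q * scalar_prod w (N *\<^sub>v w)"
    proof (rule nonneg_quadratic_imp_discriminant_le)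
      fix t
      show "0 \<le> ?q + 2 * t * scalar_prod v (N *\<^sub>v w) + t\<^sup>2 * scalar_prod w (N *\<^sub>v w)"
        using psd[of "v + t \<cdot>\<^sub>v w"] v w by (simp add: quadratic_form_add_smult[OF N sym v w])
    qed (rule psd[OF w])
    also have "scalar_prod v (N *\<^sub>v w) = scalar_prod w w"
      using scalar_prod_symmetric_mat[OF N sym v w] by (simp add: w_def)
    also have "?q * scalar_prod w (N *\<^sub>v w) \<le> ?q * (C * scalar_prod w w)"
      using C(2)[OF w] psd[OF v] by (rule mult_left_mono)
    finally have "scalar_prod w w * scalar_prod w w \<le> C * ?q * scalar_prod w w"
      by (simp add: power2_eq_square algebra_simps)
    moreover have "0 \<le> C * ?q" using C(1) psd[OF v] by simp
    ultimately have "scalar_prod w w \<le> C * ?q"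
      using scalar_prod_self_nonneg[of w]
      by (cases "scalar_prod w w = 0") (auto simp: mult_le_cancel_right)
    also have "\<dots> \<le> (C + 1) * ?q" using psd[OF v] by (simp add: algebra_simps)
    finally have w_le: "scalar_prod w w \<le> (C + 1) * ?q" .
    have "B *\<^sub>v w = v"
      unfolding w_def using assoc_mult_mat_vec[OF B(1) N v] B(2) v by simp
    then have "scalar_prod v v \<le> D * scalar_prod w w" using D(2)[OF w] by simp
    also have "\<dots> \<le> (D + 1) * scalar_prod w w"
      using scalar_prod_self_nonneg[of w] by (simp add: algebra_simps)
    also have "\<dots> \<le> (D + 1) * ((C + 1) * ?q)" using w_le D(1) by (intro mult_left_mono) auto
    finally show "1 / ((D + 1) * (C + 1)) * scalar_prod v v \<le> ?q"
      using C(1) D(1) by (simp add: pos_divide_le_eq mult_ac)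
  qed
qed

lemma exists_eigenvalue_bounding_quadratic_form:
  assumes M: "(M :: real mat) \<in> carrier_mat n n" and sym: "transpose_mat M = M" and n: "n > 0"
  obtains \<mu> where "\<mu> \<in> spectrum M"
    "\<And>v. v \<in> carrier_vec n \<Longrightarrow> scalar_prod v (M *\<^sub>v v) \<le> \<mu> * scalar_prod v v"
proof -
  \<comment> \<open>The supremum of the Rayleigh quotient is taken as the infimum of its upper
    bounds: coercivity of \<open>N\<close> with constant \<open>c\<close> then puts
    \<open>\<mu> - c\<close> into \<open>T\<close>, a direct contradiction.\<close>
  define T where "T = {r. \<forall>v \<in> carrier_vec n. scalar_prod v (M *\<^sub>v v) \<le> r * scalar_prod v v}"
  define \<mu> where "\<mu> = Inf T"
  have quot: "scalar_prod v (M *\<^sub>v v) / scalar_prod v v \<le> r"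
    if "r \<in> T" "v \<in> carrier_vec n" "v \<noteq> 0\<^sub>v n" for r v
    using that scalar_prod_self_pos[OF that(2,3)] by (auto simp: T_def pos_divide_le_eq)
  \<comment> \<open>The quotient at one nonzero vector bounds \<open>T\<close> from below; this is
    where \<open>n > 0\<close> enters.\<close>
  have unit: "unit_vec n 0 \<in> carrier_vec n" "unit_vec n 0 \<noteq> (0\<^sub>v n :: real vec)"
    using n by (auto simp: unit_vec_def zero_vec_def vec_eq_iff)
  have bdd: "bdd_below T"
    using quot[OF _ unit] by (auto intro!: bdd_belowI)
  have ne: "T \<noteq> {}"
  proof -
    obtain C where "\<And>v. v \<in> carrier_vec n \<Longrightarrow> scalar_prod v (M *\<^sub>v v) \<le> C * scalar_prod v v"
      using quadratic_form_bounded[OF M] by blast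
    then have "C \<in> T" by (simp add: T_def)
    then show ?thesis by blast
  qed
  have bound: "scalar_prod v (M *\<^sub>v v) \<le> \<mu> * scalar_prod v v" if v: "v \<in> carrier_vec n" for v
  proof (cases "v = 0\<^sub>v n")
    case True
    then show ?thesis using M by simp
  next
    case False
    have "scalar_prod v (M *\<^sub>v v) / scalar_prod v v \<le> \<mu>"
      unfolding \<mu>_def by (rule cInf_greatest[OF ne]) (rule quot[OF _ v False])
    then show ?thesis using scalar_prod_self_pos[OF v False] by (simp add: pos_divide_le_eq)
  qed
  define N where "N = \<mu> \<cdot>\<^sub>m 1\<^sub>m n - M"
  have N: "N \<in> carrier_mat n n" unfolding N_def by (rule minus_carrier_mat[OF M])
  have Nv: "N *\<^sub>v v = \<mu> \<cdot>\<^sub>v v - M *\<^sub>v v" if v: "v \<in> carrier_vec n" for v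
  proof -
    have "(\<mu> \<cdot>\<^sub>m 1\<^sub>m n) *\<^sub>v v = \<mu> \<cdot>\<^sub>v v"
      by (rule eq_vecI) (use v in auto)
    then show ?thesis
      unfolding N_def using M v by (subst minus_mult_distrib_mat_vec[where nr = n and nc = n]) auto
  qed
  have form: "scalar_prod v (N *\<^sub>v v) = \<mu> * scalar_prod v v - scalar_prod v (M *\<^sub>v v)"
    if v: "v \<in> carrier_vec n" for v
    unfolding Nv[OF v] using M v
    by (subst scalar_prod_minus_distrib[where n = n]) auto
  have symN: "transpose_mat N = N"
    unfolding N_def by (subst transpose_minus[where nr = n and nc = n]) (use M sym in \<open>auto intro!: eq_matI\<close>)
  have "Determinant.det N = 0"
  proof (rule ccontr)
    assume "Determinant.det N \<noteq> 0"
    then obtain c where c: "c > 0"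
      "\<And>v. v \<in> carrier_vec n \<Longrightarrow> c * scalar_prod v v \<le> scalar_prod v (N *\<^sub>v v)"
      using psd_invertible_coercive[OF N symN] form bound by auto
    then have "\<mu> - c \<in> T"
      unfolding T_def using form by (auto simp: algebra_simps)
    then have "\<mu> \<le> \<mu> - c" unfolding \<mu>_def by (rule cInf_lower[OF _ bdd])
    then show False using c(1) by simp
  qed
  then obtain v where v: "v \<in> carrier_vec n" "v \<noteq> 0\<^sub>v n" "N *\<^sub>v v = 0\<^sub>v n"
    using det_0_iff_vec_prod_zero_field[OF N] by blast
  have "M *\<^sub>v v = \<mu> \<cdot>\<^sub>v v"
  proof (rule eq_vecI)
    fix i assume "i < dim_vec (\<mu> \<cdot>\<^sub>v v)"
    then have i: "i < n" using v(1) by simp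
    have "(N *\<^sub>v v) $ i = 0" using v(3) i by simp
    then show "(M *\<^sub>v v) $ i = (\<mu> \<cdot>\<^sub>v v) $ i" unfolding Nv[OF v(1)] using i M v(1) by simp
  qed (use M v in auto)
  then have "\<mu> \<in> spectrum M"
    using M v by (auto simp: spectrum_def eigenvalue_def eigenvector_def)
  then show thesis using bound that by blast
qed

text \<open>The eigenvalue that bounds the form from above is at most the largest one. The lower
  bound is the same argument for \<open>- M\<close>, whose eigenvalues are the negatives of those of
  \<open>M\<close>.\<close>

lemma spectrum_bounds_quadratic_form:
  assumes M: "(M :: real mat) \<in> carrier_mat n n" and sym: "transpose_mat M = M" and n: "n > 0"
    and v: "v \<in> carrier_vec n"
  shows "scalar_prod v (M *\<^sub>v v) \<le> Max (spectrum M) * scalar_prod v v"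
    and "Min (spectrum M) * scalar_prod v v \<le> scalar_prod v (M *\<^sub>v v)"
    and "spectrum M \<noteq> {}"
proof -
  note fin = card_finite_spectrum(1)[OF M]
  obtain \<mu> where \<mu>: "\<mu> \<in> spectrum M"
    "\<And>v. v \<in> carrier_vec n \<Longrightarrow> scalar_prod v (M *\<^sub>v v) \<le> \<mu> * scalar_prod v v"
    using exists_eigenvalue_bounding_quadratic_form[OF M sym n] by blast
  show "spectrum M \<noteq> {}" using \<mu>(1) by blast
  have "\<mu> * scalar_prod v v \<le> Max (spectrum M) * scalar_prod v v"
    using Max_ge[OF fin \<mu>(1)] by (rule mult_right_mono[OF _ scalar_prod_self_nonneg])
  then show "scalar_prod v (M *\<^sub>v v) \<le> Max (spectrum M) * scalar_prod v v"
    using \<mu>(2)[OF v] by linarith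
  have neg: "(- M) *\<^sub>v w = - (M *\<^sub>v w)" if "w \<in> carrier_vec n" for w
    using M that by (auto simp: uminus_mult_mat_vec)
  have mM: "- M \<in> carrier_mat n n" "transpose_mat (- M) = - M"
    using M sym by (auto simp: transpose_uminus)
  obtain \<nu> where \<nu>: "\<nu> \<in> spectrum (- M)"
    "\<And>v. v \<in> carrier_vec n \<Longrightarrow> scalar_prod v (- M *\<^sub>v v) \<le> \<nu> * scalar_prod v v"
    using exists_eigenvalue_bounding_quadratic_form[OF mM n] by blast
  obtain w where w: "w \<in> carrier_vec n" "w \<noteq> 0\<^sub>v n" "- M *\<^sub>v w = \<nu> \<cdot>\<^sub>v w"
    using \<nu>(1) mM(1) M by (auto simp: spectrum_def eigenvalue_def eigenvector_def)
  have "M *\<^sub>v w = - \<nu> \<cdot>\<^sub>v w"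
  proof (rule eq_vecI)
    fix i assume i: "i < dim_vec (- \<nu> \<cdot>\<^sub>v w)"
    have "(- M *\<^sub>v w) $ i = (\<nu> \<cdot>\<^sub>v w) $ i" using w(3) by simp
    then show "(M *\<^sub>v w) $ i = (- \<nu> \<cdot>\<^sub>v w) $ i"
      unfolding neg[OF w(1)] using i M w(1) by simp
  qed (use M w in auto)
  then have "- \<nu> \<in> spectrum M"
    using M w by (auto simp: spectrum_def eigenvalue_def eigenvector_def)
  then have "Min (spectrum M) * scalar_prod v v \<le> - \<nu> * scalar_prod v v"
    by (intro mult_right_mono scalar_prod_self_nonneg Min_le fin)
  moreover have "scalar_prod v (- M *\<^sub>v v) = - scalar_prod v (M *\<^sub>v v)"
    unfolding neg[OF v] using M v by (intro scalar_prod_uminus_right) auto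
  ultimately show "Min (spectrum M) * scalar_prod v v \<le> scalar_prod v (M *\<^sub>v v)"
    using \<nu>(2)[OF v] by simp
qed

lemma positive_definite_Min_spectrum_pos:
  assumes M: "positive_definite n M" and n: "n > 0"
  shows "0 < Min (spectrum M)"
proof -
  have carr: "M \<in> carrier_mat n n" and sym: "transpose_mat M = M"
    and pos: "\<And>v. v \<in> carrier_vec n \<Longrightarrow> v \<noteq> 0\<^sub>v n \<Longrightarrow> scalar_prod v (M *\<^sub>v v) > 0"
    using M by (auto simp: positive_definite_def)
  have "Min (spectrum M) \<in> spectrum M"
    by (rule Min_in[OF card_finite_spectrum(1)[OF carr]
          spectrum_bounds_quadratic_form(3)[OF carr sym n zero_carrier_vec]])
  then obtain v where v: "v \<in> carrier_vec n" "v \<noteq> 0\<^sub>v n" "M *\<^sub>v v = Min (spectrum M) \<cdot>\<^sub>v v"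
    using carr by (auto simp: spectrum_def eigenvalue_def eigenvector_def)
  then have "0 < Min (spectrum M) * scalar_prod v v" using pos[OF v(1,2)] by simp
  then show ?thesis using scalar_prod_self_nonneg[of v] by (simp add: zero_less_mult_iff)
qed

text \<open>
  The quadratic form of \<open>A\<close> at column \<open>p\<close> of the adjugate equals \<open>det A\<close> times the minor, and the
  \<open>p\<close>-th entry of that column is the minor.
\<close>

lemma det_ratio_bounds:
  assumes A: "(A :: real mat) \<in> carrier_mat m m" and sym: "transpose_mat A = A" and p: "p < m"
    and lo: "\<And>v. v \<in> carrier_vec m \<Longrightarrow> l * scalar_prod v v \<le> scalar_prod v (A *\<^sub>v v)"
    and hi: "\<And>v. v \<in> carrier_vec m \<Longrightarrow> scalar_prod v (A *\<^sub>v v) \<le> h * scalar_prod v v"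
    and l: "0 < l" and d: "0 < Determinant.det (mat_delete A p p)"
  shows "l * Determinant.det (mat_delete A p p) \<le> Determinant.det A"
    and "Determinant.det A \<le> h * Determinant.det (mat_delete A p p)"
proof -
  let ?D = "Determinant.det A" and ?d = "Determinant.det (mat_delete A p p)"
  define w where "w = Matrix.col (adj_mat A) p"
  note adj = adj_mat[OF A]
  have w: "w \<in> carrier_vec m" using adj(1) by (auto simp: w_def)
  have wp: "w $ p = ?d"
    using A p by (simp add: w_def adj_mat_def cofactor_def)
  have "A *\<^sub>v w = Matrix.col (A * adj_mat A) p"
    unfolding w_def using col_mult2[OF A adj(1) p] by simp
  also have "\<dots> = ?D \<cdot>\<^sub>v unit_vec m p"
    unfolding adj(2) using p by (auto simp: unit_vec_def)
  finally have Aw: "A *\<^sub>v w = ?D \<cdot>\<^sub>v unit_vec m p" .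
  have qw: "scalar_prod w (A *\<^sub>v w) = ?D * ?d"
    unfolding Aw using w p wp by simp
  \<comment> \<open>The entry of \<open>w\<close> at \<open>p\<close> is the minor, so the squared
    length of \<open>w\<close> is at least the square of the minor.\<close>
  have "l * ?d\<^sup>2 \<le> l * scalar_prod w w"
    using index_square_le_scalar_prod_self[of p w] w p wp l by simp
  also have "\<dots> \<le> ?D * ?d" using lo[OF w] qw by simp
  finally have "(l * ?d) * ?d \<le> ?D * ?d" by (simp add: power2_eq_square mult.assoc)
  then show "l * ?d \<le> ?D" using d by simp
  let ?e = "unit_vec m p :: real vec"
  have e: "?e \<in> carrier_vec m" by simp
  have "scalar_prod w (A *\<^sub>v ?e) = ?D"
    using scalar_prod_symmetric_mat[OF A sym w e] p unfolding Aw by simp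
  \<comment> \<open>Subtracting \<open>?d\<close> times the unit vector makes the entry at
    \<open>p\<close> vanish. Nonnegativity of the form at this vector says that \<open>?D\<close> is
    at most the minor times the diagonal entry of \<open>A\<close> at \<open>p\<close>, and that
    entry is at most \<open>h\<close>.\<close>
  then have "scalar_prod (w + (- ?d) \<cdot>\<^sub>v ?e) (A *\<^sub>v (w + (- ?d) \<cdot>\<^sub>v ?e))
      = ?d\<^sup>2 * scalar_prod ?e (A *\<^sub>v ?e) - ?D * ?d"
    unfolding quadratic_form_add_smult[OF A sym w e] qw by simp
  moreover have "0 \<le> l * scalar_prod (w + (- ?d) \<cdot>\<^sub>v ?e) (w + (- ?d) \<cdot>\<^sub>v ?e)"
    by (intro mult_nonneg_nonneg scalar_prod_self_nonneg less_imp_le[OF l])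
  moreover have "w + (- ?d) \<cdot>\<^sub>v ?e \<in> carrier_vec m" using w by simp
  ultimately have "?D * ?d \<le> ?d\<^sup>2 * scalar_prod ?e (A *\<^sub>v ?e)"
    using lo by fastforce
  also have "\<dots> \<le> ?d\<^sup>2 * h"
    using hi[OF e] p by (intro mult_left_mono) auto
  finally have "?D * ?d \<le> (h * ?d) * ?d" by (simp add: power2_eq_square mult_ac)
  then show "?D \<le> h * ?d" using d by simp
qed

section \<open>Determinants of principal submatrices\<close>

lemma principal_submatrix_carrier:
  assumes "M \<in> carrier_mat n n" "I \<subseteq> {..<n}"
  shows "principal_submatrix M I \<in> carrier_mat (card I) (card I)"
proof -
  have "{i. i < n \<and> i \<in> I} = I" using assms(2) by auto
  then show ?thesis
    using carrier_matD[OF assms(1)]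
    by (intro carrier_matI) (simp_all only: principal_submatrix_def dim_submatrix)
qed

lemma principal_submatrix_index:
  assumes "M \<in> carrier_mat n n" "I \<subseteq> {..<n}" "a < card I" "b < card I"
  shows "principal_submatrix M I $$ (a, b) = M $$ (pick I a, pick I b)"
proof -
  have "{i. i < n \<and> i \<in> I} = I" using assms(2) by auto
  then show ?thesis
    using assms(3,4) carrier_matD[OF assms(1)]
    unfolding principal_submatrix_def by (subst submatrix_index) simp_all
qed

text \<open>\<open>pick I\<close> enumerates \<open>I\<close> increasingly; its inverse is the rank,
  the number of smaller elements of \<open>I\<close>.\<close>

lemma bij_betw_pick:
  assumes "finite I"
  shows "bij_betw (pick I) {..<card I} I"
proof (rule bij_betw_byWitness[where f' = "\<lambda>j. card {a \<in> I. a < j}"])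
  show "\<forall>a\<in>{..<card I}. card {b \<in> I. b < pick I a} = a"
    using card_pick by auto
  show "\<forall>j\<in>I. pick I (card {a \<in> I. a < j}) = j" by (simp add: pick_card_in_set)
  show "pick I ` {..<card I} \<subseteq> I" using pick_in_set_le by blast
  show "(\<lambda>j. card {a \<in> I. a < j}) ` I \<subseteq> {..<card I}"
    using assms by (auto intro!: psubset_card_mono)
qed

text \<open>The row of \<open>i\<close> in the submatrix is the rank of \<open>i\<close> in
  \<open>I\<close>. Removing \<open>i\<close> lowers the rank of larger elements by one and keeps
  that of smaller ones, which is the index shift made by \<open>mat_delete\<close>.\<close>

lemma mat_delete_principal_submatrix:
  assumes M: "M \<in> carrier_mat n n" and I: "I \<subseteq> {..<n}" and i: "i \<in> I"
  shows "mat_delete (principal_submatrix M I) (card {a \<in> I. a < i}) (card {a \<in> I. a < i})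
    = principal_submatrix M (I - {i})"
proof -
  have fin: "finite I" using I finite_subset by blast
  define p where "p = card {a \<in> I. a < i}"
  have pI: "pick I p = i" unfolding p_def by (rule pick_card_in_set[OF i])
  have p: "p < card I" unfolding p_def using fin i by (auto intro!: psubset_card_mono)
  have cI: "card (I - {i}) = card I - 1" using fin i by simp
  have pick_delete: "pick I (if a < p then a else Suc a) = pick (I - {i}) a" if a: "a < card I - 1" for a
  proof -
    define a' where "a' = (if a < p then a else Suc a)"
    define j where "j = pick I a'"
    have a': "a' < card I" "a' \<noteq> p" using a p by (auto simp: a'_def)
    have j: "j \<in> I" unfolding j_def by (rule pick_in_set_le[OF a'(1)])
    have cj: "card {b \<in> I. b < j} = a'" unfolding j_def by (rule card_pick[OF disjI1[OF a'(1)]])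
    have ji: "j \<noteq> i" using cj a'(2) p_def by auto
    have card_below: "card {b \<in> I - {i}. b < j} = a"
    proof (cases "i < j")
      case True
      then have "{b \<in> I. b < i} \<subset> {b \<in> I. b < j}" using i by auto
      then have "p < a'" unfolding p_def cj[symmetric] using fin by (intro psubset_card_mono) auto
      then have "a' = Suc a" by (auto simp: a'_def split: if_splits)
      moreover have "{b \<in> I - {i}. b < j} = {b \<in> I. b < j} - {i}" by auto
      moreover have "card ({b \<in> I. b < j} - {i}) = a' - 1"
        unfolding cj[symmetric] using True i by (intro card_Diff_singleton) simp
      ultimately show ?thesis by (metis diff_Suc_1)
    next
      case False
      then have "j < i" using ji by linarith
      then have "{b \<in> I. b < j} \<subseteq> {b \<in> I. b < i}" "j \<in> {b \<in> I. b < i}" using j by auto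
      moreover have "j \<notin> {b \<in> I. b < j}" by simp
      ultimately have "{b \<in> I. b < j} \<subset> {b \<in> I. b < i}" by blast
      then have "a' < p" unfolding p_def cj[symmetric] using fin by (intro psubset_card_mono) auto
      then have "a' = a" by (auto simp: a'_def split: if_splits)
      moreover have "{b \<in> I - {i}. b < j} = {b \<in> I. b < j}" using \<open>j < i\<close> by auto
      ultimately show ?thesis using cj by metis
    qed
    have "j \<in> I - {i}" using j ji by blast
    then have "pick (I - {i}) a = j" using pick_card_in_set[of j "I - {i}"] unfolding card_below by blast
    then show ?thesis unfolding j_def a'_def by (rule sym)
  qed
  have carr: "principal_submatrix M I \<in> carrier_mat (card I) (card I)"
    by (rule principal_submatrix_carrier[OF M I])
  have carr': "principal_submatrix M (I - {i}) \<in> carrier_mat (card I - 1) (card I - 1)"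
    using principal_submatrix_carrier[OF M, of "I - {i}"] I cI by auto
  have "mat_delete (principal_submatrix M I) p p = principal_submatrix M (I - {i})"
  proof (rule eq_matI)
    fix a b assume "a < dim_row (principal_submatrix M (I - {i}))" "b < dim_col (principal_submatrix M (I - {i}))"
    then have ab: "a < card I - 1" "b < card I - 1" using carr' by auto
    have "mat_delete (principal_submatrix M I) p p $$ (a, b)
      = principal_submatrix M I $$ (if a < p then a else Suc a, if b < p then b else Suc b)"
      using ab carr unfolding mat_delete_def by auto
    also have "\<dots> = M $$ (pick (I - {i}) a, pick (I - {i}) b)"
      using ab pick_delete by (subst principal_submatrix_index[OF M I]) auto
    also have "\<dots> = principal_submatrix M (I - {i}) $$ (a, b)"
      using ab cI I by (subst principal_submatrix_index[OF M]) auto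
    finally show "mat_delete (principal_submatrix M I) p p $$ (a, b)
      = principal_submatrix M (I - {i}) $$ (a, b)" .
  qed (use carr carr' in auto)
  then show ?thesis by (simp add: p_def)
qed

lemma principal_submatrix_quadratic_form:
  assumes M: "M \<in> carrier_mat n n" and I: "I \<subseteq> {..<n}" and w: "w \<in> carrier_vec (card I)"
  obtains v where "v \<in> carrier_vec n" "scalar_prod v v = scalar_prod w w"
    "scalar_prod v (M *\<^sub>v v) = scalar_prod w (principal_submatrix M I *\<^sub>v w)"
proof
  have fin: "finite I" using I finite_subset by blast
  \<comment> \<open>The vector \<open>w\<close> spread over the positions in \<open>I\<close> and
    padded with zeros elsewhere.\<close>
  define x where "x j = (if j \<in> I then w $ card {a \<in> I. a < j} else 0)" for j
  have x_pick: "x (pick I a) = w $ a" if "a < card I" for a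
    using that pick_in_set_le[OF that] card_pick[OF disjI1[OF that]] by (simp add: x_def)
  have sum_x: "(\<Sum>j<n. x j * g j) = (\<Sum>a<card I. w $ a * g (pick I a))" for g
  proof -
    have "(\<Sum>j<n. x j * g j) = (\<Sum>j\<in>I. x j * g j)"
      using I by (intro sum.mono_neutral_right) (auto simp: x_def)
    also have "\<dots> = (\<Sum>a<card I. x (pick I a) * g (pick I a))"
      using sum.reindex_bij_betw[OF bij_betw_pick[OF fin], of "\<lambda>j. x j * g j"] by simp
    also have "\<dots> = (\<Sum>a<card I. w $ a * g (pick I a))"
      by (rule sum.cong) (auto simp: x_pick)
    finally show ?thesis .
  qed
  let ?v = "Matrix.vec n x" and ?A = "principal_submatrix M I"
  show "?v \<in> carrier_vec n" by simp
  have "scalar_prod ?v ?v = (\<Sum>j<n. x j * x j)"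
    by (simp add: scalar_prod_def atLeast0LessThan)
  also have "\<dots> = scalar_prod w w"
    unfolding sum_x using w by (auto simp: scalar_prod_def atLeast0LessThan x_pick)
  finally show "scalar_prod ?v ?v = scalar_prod w w" .
  have "scalar_prod ?v (M *\<^sub>v ?v) = (\<Sum>i<n. x i * (\<Sum>j<n. x j * M $$ (i, j)))"
    using M by (auto simp: scalar_prod_def atLeast0LessThan mult_ac intro!: sum.cong)
  also have "\<dots> = (\<Sum>a<card I. w $ a * (\<Sum>b<card I. w $ b * M $$ (pick I a, pick I b)))"
    by (simp add: sum_x)
  also have "\<dots> = scalar_prod w (?A *\<^sub>v w)"
    using w principal_submatrix_carrier[OF M I]
    by (auto simp: scalar_prod_def atLeast0LessThan mult_ac principal_submatrix_index[OF M I]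
        intro!: sum.cong)
  finally show "scalar_prod ?v (M *\<^sub>v ?v) = scalar_prod w (?A *\<^sub>v w)" .
qed

lemma principal_submatrix_symmetric:
  assumes M: "M \<in> carrier_mat n n" and sym: "transpose_mat M = M" and I: "I \<subseteq> {..<n}"
  shows "transpose_mat (principal_submatrix M I) = principal_submatrix M I"
proof (rule eq_matI)
  note carr = principal_submatrix_carrier[OF M I]
  fix a b assume "a < dim_row (principal_submatrix M I)" "b < dim_col (principal_submatrix M I)"
  then have ab: "a < card I" "b < card I" using carr by auto
  then have "pick I a < n" "pick I b < n" using pick_in_set_le I by blast+
  then have "M $$ (pick I a, pick I b) = M $$ (pick I b, pick I a)"
    using sym M by (metis carrier_matD index_transpose_mat(1))
  then show "transpose_mat (principal_submatrix M I) $$ (a, b) = principal_submatrix M I $$ (a, b)"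
    using ab carr by (auto simp: principal_submatrix_index[OF M I])
qed (use principal_submatrix_carrier[OF M I] in auto)

text \<open>Positivity of the smaller determinant is a hypothesis because
  \<open>det_principal_submatrix_pos\<close> derives it from this very lemma by induction on the
  index set.\<close>

lemma det_principal_submatrix_insert:
  assumes M: "M \<in> carrier_mat n n" and sym: "transpose_mat M = M"
    and lo: "\<And>v. v \<in> carrier_vec n \<Longrightarrow> l * scalar_prod v v \<le> scalar_prod v (M *\<^sub>v v)"
    and hi: "\<And>v. v \<in> carrier_vec n \<Longrightarrow> scalar_prod v (M *\<^sub>v v) \<le> h * scalar_prod v v"
    and l: "0 < l" and J: "insert x J \<subseteq> {..<n}" "x \<notin> J"
    and d: "0 < Determinant.det (principal_submatrix M J)"
  shows "l * Determinant.det (principal_submatrix M J) \<le> Determinant.det (principal_submatrix M (insert x J))"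
    and "Determinant.det (principal_submatrix M (insert x J)) \<le> h * Determinant.det (principal_submatrix M J)"
proof -
  let ?I = "insert x J"
  let ?A = "principal_submatrix M ?I"
  define p where "p = card {a \<in> ?I. a < x}"
  have "finite ?I" by (rule finite_subset[OF J(1)]) simp
  then have p: "p < card ?I"
    unfolding p_def using psubset_card_mono[of ?I "{a \<in> ?I. a < x}"] by blast
  have del: "mat_delete ?A p p = principal_submatrix M J"
    using mat_delete_principal_submatrix[OF M J(1), of x] J(2) by (simp add: p_def)
  have form: "l * scalar_prod w w \<le> scalar_prod w (?A *\<^sub>v w)"
    "scalar_prod w (?A *\<^sub>v w) \<le> h * scalar_prod w w" if w: "w \<in> carrier_vec (card ?I)" for w
  proof -
    obtain v where "v \<in> carrier_vec n" "scalar_prod v v = scalar_prod w w"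
      "scalar_prod v (M *\<^sub>v v) = scalar_prod w (?A *\<^sub>v w)"
      using principal_submatrix_quadratic_form[OF M J(1) w] by blast
    then show "l * scalar_prod w w \<le> scalar_prod w (?A *\<^sub>v w)"
      "scalar_prod w (?A *\<^sub>v w) \<le> h * scalar_prod w w"
      using lo[of v] hi[of v] by simp_all
  qed
  note ratio = det_ratio_bounds[OF principal_submatrix_carrier[OF M J(1)]
      principal_submatrix_symmetric[OF M sym J(1)] p form l, unfolded del]
  show "l * Determinant.det (principal_submatrix M J) \<le> Determinant.det ?A"
    by (rule ratio(1)) (use d in auto)
  show "Determinant.det ?A \<le> h * Determinant.det (principal_submatrix M J)"
    by (rule ratio(2)) (use d in auto)
qed

lemma det_principal_submatrix_pos:
  assumes M: "M \<in> carrier_mat n n" and sym: "transpose_mat M = M"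
    and lo: "\<And>v. v \<in> carrier_vec n \<Longrightarrow> l * scalar_prod v v \<le> scalar_prod v (M *\<^sub>v v)"
    and hi: "\<And>v. v \<in> carrier_vec n \<Longrightarrow> scalar_prod v (M *\<^sub>v v) \<le> h * scalar_prod v v"
    and l: "0 < l" and I: "I \<subseteq> {..<n}"
  shows "0 < Determinant.det (principal_submatrix M I)"
proof -
  have "finite I" using I finite_subset by blast
  then show ?thesis using I
  proof (induction I)
    case empty
    have "principal_submatrix M {} \<in> carrier_mat 0 0" using principal_submatrix_carrier[OF M, of "{}"] by simp
    then show ?case by (simp add: det_dim_zero)
  next
    case (insert x J)
    then have d: "0 < Determinant.det (principal_submatrix M J)" by simp
    then have "0 < l * Determinant.det (principal_submatrix M J)" using l by simp
    also have "\<dots> \<le> Determinant.det (principal_submatrix M (insert x J))"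
      by (rule det_principal_submatrix_insert(1)[OF M sym lo hi l _ _ d]) (use insert in auto)
    finally show ?case .
  qed
qed

text \<open>Both enlarged sets add to the log-determinant of \<open>J\<close> an amount between
  \<open>ln ?l\<close> and \<open>ln ?h\<close>, so the two differ by at most the length of this
  interval.\<close>

lemma swap_bounded_log_det:
  assumes M: "positive_definite n M" and n: "n > 0"
  shows "swap_bounded (ln (condition_number M)) {..<n} (\<lambda>I. log_det (principal_submatrix M I))"
    and "1 \<le> condition_number M"
proof -
  have carr: "M \<in> carrier_mat n n" and sym: "transpose_mat M = M"
    using M by (auto simp: positive_definite_def)
  let ?l = "Min (spectrum M)" and ?h = "Max (spectrum M)"
  let ?d = "\<lambda>I. Determinant.det (principal_submatrix M I)"
  note bounds = spectrum_bounds_quadratic_form[OF carr sym n]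
  have l: "0 < ?l" by (rule positive_definite_Min_spectrum_pos[OF M n])
  have lh: "?l \<le> ?h"
    using card_finite_spectrum(1)[OF carr] bounds(3)[OF zero_carrier_vec] by simp
  show "1 \<le> condition_number M" using l lh by (simp add: condition_number_def)
  have L: "ln (condition_number M) = ln ?h - ln ?l"
    using l lh by (simp add: condition_number_def ln_div)
  have step: "ln ?l + ln (?d J) \<le> ln (?d (insert x J))" "ln (?d (insert x J)) \<le> ln ?h + ln (?d J)"
    if "J \<subseteq> {..<n}" "x \<in> {..<n} - J" for J x
  proof -
    have pos: "0 < ?d J" "0 < ?d (insert x J)"
      using det_principal_submatrix_pos[OF carr sym bounds(2) bounds(1) l] that by auto
    have "insert x J \<subseteq> {..<n}" "x \<notin> J" using that by auto
    note ratio = det_principal_submatrix_insert[OF carr sym bounds(2) bounds(1) l this pos(1)]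
    have "ln (?l * ?d J) \<le> ln (?d (insert x J))" "ln (?d (insert x J)) \<le> ln (?h * ?d J)"
      using ratio pos l by auto
    then show "ln ?l + ln (?d J) \<le> ln (?d (insert x J))" "ln (?d (insert x J)) \<le> ln ?h + ln (?d J)"
      using l lh pos by (auto simp: ln_mult)
  qed
  show "swap_bounded (ln (condition_number M)) {..<n} (\<lambda>I. log_det (principal_submatrix M I))"
    unfolding swap_bounded_def L log_det_def
  proof (intro allI impI ballI)
    fix J x y assume "J \<subseteq> {..<n}" "x \<in> {..<n} - J" "y \<in> {..<n} - J"
    then show "\<bar>ln (?d (insert x J)) - ln (?d (insert y J))\<bar> \<le> ln ?h - ln ?l"
      using step[of J x] step[of J y] by linarith
  qed
qed

text \<open>Since \<open>pick I\<close> is strictly increasing, entries below the diagonal of the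
  submatrix come from entries off the diagonal of \<open>M\<close>; hence its determinant is the
  product of its diagonal.\<close>

lemma log_det_principal_submatrix_diagonal:
  assumes M: "M \<in> carrier_mat n n" "diagonal_mat M" and I: "I \<subseteq> {..<n}"
    and pos: "\<And>i. i \<in> I \<Longrightarrow> 0 < M $$ (i, i)"
  shows "log_det (principal_submatrix M I) = (\<Sum>i\<in>I. ln (M $$ (i, i)))"
proof -
  have fin: "finite I" using I finite_subset by blast
  let ?A = "principal_submatrix M I"
  note carr = principal_submatrix_carrier[OF M(1) I]
  have "upper_triangular ?A"
  proof (rule upper_triangularI)
    fix a b assume ab: "b < a" "a < dim_row ?A"
    then have ab': "a < card I" "b < card I" using carr by auto
    then have "pick I a < n" "pick I b < n" using pick_in_set_le I by blast+
    moreover have "pick I b < pick I a" by (rule pick_mono_le[OF ab'(1) ab(1)])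
    ultimately show "?A $$ (a, b) = 0"
      using M ab' by (simp add: principal_submatrix_index[OF M(1) I] diagonal_mat_def)
  qed
  then have "Determinant.det ?A = prod_list (diag_mat ?A)"
    using carr by (rule det_upper_triangular)
  also have "\<dots> = (\<Prod>a<card I. ?A $$ (a, a))"
    using carr by (simp add: diag_mat_def prod.list_conv_set_nth atLeast0LessThan)
  also have "\<dots> = (\<Prod>a<card I. M $$ (pick I a, pick I a))"
    by (rule prod.cong) (auto simp: principal_submatrix_index[OF M(1) I])
  also have "\<dots> = (\<Prod>i\<in>I. M $$ (i, i))"
    by (rule prod.reindex_bij_betw[OF bij_betw_pick[OF fin]])
  finally show ?thesis using pos fin by (simp add: log_det_def ln_prod less_imp_neq[symmetric])
qed

section \<open>Sample means\<close>

text \<open>In the expanded square of the centered sum, independence makes the mixed terms vanish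
  and leaves \<open>q\<close> copies of the variance. Finite support makes every real function of a
  sample integrable, so \<open>f\<close> can be arbitrary.\<close>

lemma variance_sample_mean:
  fixes f :: "'a \<Rightarrow> real"
  assumes iid: "iid_sample P q p A" and fin: "finite (set_pmf p)" and q: "q \<ge> 1"
  shows "prob_space.variance P (sample_mean q f A) = measure_pmf.variance p f / real q"
proof -
  interpret prob_space P using iid by (simp add: iid_sample_def)
  have indep: "indep_vars (\<lambda>_. count_space UNIV) A {1..q}"
    and law: "\<And>i. i \<in> {1..q} \<Longrightarrow> distr P (count_space UNIV) (A i) = measure_pmf p"
    using iid by (auto simp: iid_sample_def)
  have rv: "A i \<in> measurable P (count_space UNIV)" if "i \<in> {1..q}" for i
    using indep that by (simp add: indep_vars_def2)
  have int_p: "integrable p h" for h :: "'a \<Rightarrow> real"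
    by (rule integrable_measure_pmf_finite[OF fin])
  have int_A: "integrable P (\<lambda>\<omega>. h (A i \<omega>))" if "i \<in> {1..q}" for h :: "'a \<Rightarrow> real" and i
    using int_p[of h] integrable_distr_eq[OF rv[OF that], of h] by (simp add: law[OF that])
  have exp_A: "expectation (\<lambda>\<omega>. h (A i \<omega>)) = measure_pmf.expectation p h"
    if "i \<in> {1..q}" for h :: "'a \<Rightarrow> real" and i
    using integral_distr[OF rv[OF that], of h] by (simp add: law[OF that])
  define \<mu> where "\<mu> = measure_pmf.expectation p f"
  define g where "g a = f a - \<mu>" for a
  have exp_g: "measure_pmf.expectation p g = 0"
    unfolding g_def using int_p[of f] by (simp add: \<mu>_def)
  have mean: "expectation (sample_mean q f A) = \<mu>"
    unfolding sample_mean_def using q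
    by (simp add: Bochner_Integration.integral_sum int_A exp_A flip: \<mu>_def)
  have prod: "integrable P (\<lambda>\<omega>. g (A i \<omega>) * g (A j \<omega>))
      \<and> expectation (\<lambda>\<omega>. g (A i \<omega>) * g (A j \<omega>)) = (if i = j then measure_pmf.variance p f else 0)"
    if ij: "i \<in> {1..q}" "j \<in> {1..q}" for i j
  proof (cases "i = j")
    case True
    then show ?thesis
      using int_A[OF ij(1), of "\<lambda>a. g a * g a"] exp_A[OF ij(1), of "\<lambda>a. g a * g a"]
      by (simp add: g_def \<mu>_def power2_eq_square)
  next
    case False
    have ind: "indep_vars (\<lambda>_. borel) (\<lambda>i \<omega>. g (A i \<omega>)) {i, j}"
      by (rule indep_vars_compose2[OF indep_vars_subset[OF indep]]) (use ij in auto)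
    have int: "integrable P (\<lambda>\<omega>. g (A l \<omega>))" if "l \<in> {i, j}" for l
      using that ij by (intro int_A) auto
    show ?thesis
      using indep_vars_lebesgue_integral[OF _ ind int] indep_vars_integrable[OF _ ind int]
        exp_A[OF ij(1), of g] exp_g False
      by simp
  qed
  have "variance (sample_mean q f A)
      = expectation (\<lambda>\<omega>. (1 / (real q)\<^sup>2) * (\<Sum>i = 1..q. \<Sum>j = 1..q. g (A i \<omega>) * g (A j \<omega>)))"
  proof (rule Bochner_Integration.integral_cong)
    fix \<omega>
    have "sample_mean q f A \<omega> - \<mu> = (1 / real q) * (\<Sum>i = 1..q. g (A i \<omega>))"
      using q by (simp add: sample_mean_def g_def sum_subtractf field_simps)
    then show "(sample_mean q f A \<omega> - expectation (sample_mean q f A))\<^sup>2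
      = (1 / (real q)\<^sup>2) * (\<Sum>i = 1..q. \<Sum>j = 1..q. g (A i \<omega>) * g (A j \<omega>))"
      unfolding mean by (simp only: power_mult_distrib power_divide power_one power2_eq_square[of "sum _ _"] sum_product)
  qed simp
  also have "\<dots> = (1 / (real q)\<^sup>2) * (\<Sum>i = 1..q. \<Sum>j = 1..q. expectation (\<lambda>\<omega>. g (A i \<omega>) * g (A j \<omega>)))"
  proof -
    have "integrable P (\<lambda>\<omega>. \<Sum>j = 1..q. g (A i \<omega>) * g (A j \<omega>))" if "i \<in> {1..q}" for i
      by (rule Bochner_Integration.integrable_sum) (use prod that in blast)
    then have "expectation (\<lambda>\<omega>. \<Sum>i = 1..q. \<Sum>j = 1..q. g (A i \<omega>) * g (A j \<omega>))
        = (\<Sum>i = 1..q. expectation (\<lambda>\<omega>. \<Sum>j = 1..q. g (A i \<omega>) * g (A j \<omega>)))"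
      by (rule Bochner_Integration.integral_sum)
    also have "\<dots> = (\<Sum>i = 1..q. \<Sum>j = 1..q. expectation (\<lambda>\<omega>. g (A i \<omega>) * g (A j \<omega>)))"
      by (intro sum.cong refl Bochner_Integration.integral_sum) (use prod in blast)
    finally show ?thesis by simp
  qed
  also have "(\<Sum>i = 1..q. \<Sum>j = 1..q. expectation (\<lambda>\<omega>. g (A i \<omega>) * g (A j \<omega>)))
      = (\<Sum>i = 1..q. \<Sum>j = 1..q. if i = j then measure_pmf.variance p f else 0)"
    using prod by (intro sum.cong) auto
  also have "\<dots> = real q * measure_pmf.variance p f" by simp
  finally show ?thesis using q by (simp add: power2_eq_square)
qed

section \<open>The law of a random principal submatrix\<close>

lemma finite_set_random_principal_submatrix:
  assumes "k \<le> n"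
  shows "finite (set_pmf (random_principal_submatrix n k M))"
proof -
  have "card (k_subsets {..<n} k) = n choose k" using n_subsets[of "{..<n}" k] by simp
  then have "k_subsets {..<n} k \<noteq> {}" using assms by (metis card.empty binomial_eq_0_iff not_le)
  then show ?thesis
    by (simp add: random_principal_submatrix_def set_pmf_of_set finite_k_subsets)
qed

text \<open>Different index sets may give the same submatrix, so the sum runs over index sets rather
  than over matrices.\<close>

lemma variance_random_principal_submatrix:
  fixes f :: "real mat \<Rightarrow> real"
  assumes "k \<le> n"
  defines "K \<equiv> k_subsets {..<n} k"
  shows "measure_pmf.variance (random_principal_submatrix n k M) f
    = (\<Sum>I\<in>K. (f (principal_submatrix M I) - average K (\<lambda>I. f (principal_submatrix M I)))\<^sup>2) / real (n choose k)"
proof -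
  have card: "card K = n choose k" using n_subsets[of "{..<n}" k] by (simp add: K_def)
  then have ne: "K \<noteq> {}" using assms(1) by (metis card.empty binomial_eq_0_iff not_le)
  have fin: "finite K" unfolding K_def by (rule finite_k_subsets) simp
  have "measure_pmf.expectation (random_principal_submatrix n k M) g
      = (\<Sum>I\<in>K. g (principal_submatrix M I)) / real (n choose k)" for g :: "real mat \<Rightarrow> real"
    unfolding random_principal_submatrix_def K_def[symmetric]
    by (simp add: integral_pmf_of_set[OF ne fin] card)
  then show ?thesis by (simp add: average_def card)
qed

text \<open>This turns a combinatorial bound into one on the standard error: the factor 1/2 is the
  root of 1/4, and \<open>L'\<close> stands for the logarithm of the given bound on the condition
  number.\<close>

lemma sqrt_variance_bound:
  fixes V X L L' q :: real
  assumes "V \<le> X * (L\<^sup>2 / 4)" "0 \<le> L" "L \<le> L'" "0 \<le> X" "0 < q"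
  shows "sqrt (V / q) \<le> 1 / 2 * sqrt (X / q) * L'"
proof -
  have "V / q \<le> X * (L\<^sup>2 / 4) / q" using assms by (intro divide_right_mono) auto
  also have "\<dots> = X / q * (L / 2)\<^sup>2" by (simp add: power_divide)
  finally have "sqrt (V / q) \<le> sqrt (X / q * (L / 2)\<^sup>2)" by (rule real_sqrt_le_mono)
  also have "\<dots> = sqrt (X / q) * (L / 2)" unfolding real_sqrt_mult using assms(2) by simp
  also have "\<dots> \<le> sqrt (X / q) * (L' / 2)" using assms by (intro mult_left_mono) auto
  finally show ?thesis by simp
qed

text \<open>The sum \<open>n\<close> of \<open>k\<close> and \<open>n - k\<close> is at most twice
  the larger of them, and smaller times larger is their product.\<close>

lemma min_mult_le:
  fixes k n :: nat
  assumes "k \<le> n"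
  shows "min k (n - k) * n \<le> 2 * (k * (n - k))"
proof -
  obtain m where n: "n = k + m" using assms le_Suc_ex by blast
  show ?thesis
  proof (cases "k \<le> m")
    case True
    then have "k * (k + m) \<le> k * (2 * m)" by (intro mult_left_mono) auto
    then show ?thesis using True n by (simp add: min_def)
  next
    case False
    then have "m * (k + m) \<le> m * (2 * k)" by (intro mult_left_mono) auto
    then show ?thesis using False n by (simp add: min_def mult.commute mult.left_commute)
  qed
qed

theorem corollary1:
  fixes n k q :: nat
    and M :: "real mat"
    and \<kappa> :: real
    and P :: "'w measure"
    and A :: "nat \<Rightarrow> 'w \<Rightarrow> real mat"
    and S\<^sub>Y S\<^sub>h :: "'w \<Rightarrow> real"
  assumes M: "positive_definite n M"
    and \<kappa>: "condition_number M \<le> \<kappa>"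
    and k: "k \<in> {1..n}"
    and q: "q \<ge> 1"
    and A: "iid_sample P q (random_principal_submatrix n k M) A"
  defines "S\<^sub>Y \<equiv> sample_mean q log_det A"
    and "S\<^sub>h \<equiv> sample_mean q normal_entropy A"
  shows "standard_error P S\<^sub>h = standard_error P S\<^sub>Y / 2
    \<and> standard_error P S\<^sub>Y \<le> sqrt (6 * real k * real (n - k) / (real q * real n)) * ln \<kappa>
    \<and> standard_error P S\<^sub>Y \<le> 1 / 2 * sqrt (real (min k (n - k)) / real q) * ln \<kappa>
    \<and> (diagonal_mat M \<and> n \<ge> 2 \<longrightarrow>
         standard_error P S\<^sub>Y
           \<le> 1 / 2 * sqrt (real k * real (n - k) / (real q * real (n - 1))) * ln \<kappa>)"
proof -
  have n: "n > 0" and kn: "k \<le> n" and k1: "1 \<le> k" using k by auto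
  have carr: "M \<in> carrier_mat n n"
    and pos: "\<And>v. v \<in> carrier_vec n \<Longrightarrow> v \<noteq> 0\<^sub>v n \<Longrightarrow> scalar_prod v (M *\<^sub>v v) > 0"
    using M by (auto simp: positive_definite_def)
  define K where "K = k_subsets {..<n} k"
  define g where "g I = log_det (principal_submatrix M I)" for I
  define V where "V = (\<Sum>I\<in>K. (g I - average K g)\<^sup>2) / real (n choose k)"
  define L where "L = ln (condition_number M)"
  have finK: "finite K" unfolding K_def by (rule finite_k_subsets) simp
  have choose_pos: "0 < real (n choose k)" using kn by simp
  have cardK: "card K = n choose k" using n_subsets[of "{..<n}" k] by (simp add: K_def)
  have K_ne: "K \<noteq> {}" using cardK choose_pos by (metis card.empty less_irrefl of_nat_0)
  note variance = variance_sample_mean[OF A finite_set_random_principal_submatrix[OF kn] q]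
    variance_random_principal_submatrix[OF kn, of M, folded K_def]
  have SY: "standard_error P S\<^sub>Y = sqrt (V / real q)"
    by (simp add: standard_error_def S\<^sub>Y_def variance V_def g_def[abs_def])

  \<comment> \<open>All submatrices have dimension \<open>k\<close>, so the additive term of the
    entropy is the same for each and cancels in every deviation from the mean.\<close>
  define c where "c = real k / 2 * (1 + ln (2 * pi))"
  have entropy: "normal_entropy (principal_submatrix M I) = 1 / 2 * g I + c" if "I \<in> K" for I
  proof -
    have "principal_submatrix M I \<in> carrier_mat k k"
      using principal_submatrix_carrier[OF carr, of I] that by (auto simp: K_def)
    then show ?thesis by (simp add: normal_entropy_def g_def log_det_def c_def)
  qed
  have "average K (\<lambda>I. normal_entropy (principal_submatrix M I)) = average K (\<lambda>I. 1 / 2 * g I + c)"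
    using entropy by (simp add: average_def)
  also have "\<dots> = 1 / 2 * average K g + c" by (rule average_affine[OF finK K_ne])
  finally have average_entropy:
    "average K (\<lambda>I. normal_entropy (principal_submatrix M I)) = 1 / 2 * average K g + c" .
  have "(\<Sum>I\<in>K. (normal_entropy (principal_submatrix M I)
        - average K (\<lambda>I. normal_entropy (principal_submatrix M I)))\<^sup>2)
      = (\<Sum>I\<in>K. (1 / 4) * (g I - average K g)\<^sup>2)"
    unfolding average_entropy
    by (rule sum.cong) (simp_all add: entropy power2_eq_square algebra_simps)
  also have "\<dots> = (1 / 4) * (\<Sum>I\<in>K. (g I - average K g)\<^sup>2)" by (rule sum_distrib_left[symmetric])
  finally have quarter: "(\<Sum>I\<in>K. (normal_entropy (principal_submatrix M I)
        - average K (\<lambda>I. normal_entropy (principal_submatrix M I)))\<^sup>2)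
      = (1 / 4) * (\<Sum>I\<in>K. (g I - average K g)\<^sup>2)" .
  have "standard_error P S\<^sub>h = sqrt ((1 / 4) * (V / real q))"
    unfolding standard_error_def S\<^sub>h_def variance quarter V_def by simp
  also have "\<dots> = sqrt (1 / 4) * sqrt (V / real q)" by (rule real_sqrt_mult)
  also have "sqrt (1 / 4) = 1 / 2" by (simp add: real_sqrt_divide)
  finally have Sh: "standard_error P S\<^sub>h = standard_error P S\<^sub>Y / 2" by (simp add: SY)

  have swap: "swap_bounded L {..<n} g"
    unfolding L_def g_def[abs_def] by (rule swap_bounded_log_det(1)[OF M n])
  have \<kappa>1: "1 \<le> condition_number M" by (rule swap_bounded_log_det(2)[OF M n])
  have L0: "0 \<le> L" using \<kappa>1 by (simp add: L_def)
  have L\<kappa>: "L \<le> ln \<kappa>" using \<kappa>1 \<kappa> by (simp add: L_def)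
  have "V \<le> real (min k (n - k)) * (L\<^sup>2 / 4)"
    using k_subsets_square_deviation_le_min[OF _ swap, of k] kn choose_pos
    by (simp add: V_def K_def pos_divide_le_eq mult_ac del: of_nat_diff)
  then have min_bound: "standard_error P S\<^sub>Y \<le> 1 / 2 * sqrt (real (min k (n - k)) / real q) * ln \<kappa>"
    unfolding SY by (rule sqrt_variance_bound[OF _ L0 L\<kappa>]) (use q in auto)
  also have "1 / 2 * sqrt (real (min k (n - k)) / real q)
      \<le> sqrt (6 * real k * real (n - k) / (real q * real n))"
  proof -
    \<comment> \<open>The outer factor 1/2 enters the root as 1/4, so the constant to be reached is
      4 times 6, that is 24.\<close>
    have "real (min k (n - k)) * real n \<le> 2 * (real k * real (n - k))"
      using min_mult_le[OF kn] by (metis of_nat_le_iff of_nat_mult of_nat_numeral)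
    also have "\<dots> \<le> 24 * (real k * real (n - k))" by (intro mult_right_mono) auto
    finally have "real (min k (n - k)) / 4 \<le> 6 * real k * real (n - k) / real n"
      using n by (simp add: pos_le_divide_eq del: of_nat_diff of_nat_min)
    then have "real (min k (n - k)) / 4 / real q \<le> 6 * real k * real (n - k) / real n / real q"
      by (rule divide_right_mono) simp
    then have "1 / 4 * (real (min k (n - k)) / real q) \<le> 6 * real k * real (n - k) / (real q * real n)"
      by (simp add: mult.commute del: of_nat_diff of_nat_min)
    then have "sqrt (1 / 4 * (real (min k (n - k)) / real q))
        \<le> sqrt (6 * real k * real (n - k) / (real q * real n))"
      by (rule real_sqrt_le_mono)
    moreover have "sqrt (1 / 4 * (real (min k (n - k)) / real q)) = 1 / 2 * sqrt (real (min k (n - k)) / real q)"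
      unfolding real_sqrt_mult by (simp add: real_sqrt_divide del: of_nat_min of_nat_diff)
    ultimately show ?thesis by (simp only:)
  qed
  finally have first_bound:
    "standard_error P S\<^sub>Y \<le> sqrt (6 * real k * real (n - k) / (real q * real n)) * ln \<kappa>"
    using L0 L\<kappa> by (simp add: mult_right_mono)

  have diag_bound: "standard_error P S\<^sub>Y
      \<le> 1 / 2 * sqrt (real k * real (n - k) / (real q * real (n - 1))) * ln \<kappa>"
    if diag: "diagonal_mat M" and n2: "n \<ge> 2"
  proof -
    have M_pos: "0 < M $$ (i, i)" if i: "i < n" for i
    proof -
      have "unit_vec n i \<noteq> (0\<^sub>v n :: real vec)"
        using i by (metis index_unit_vec(1) index_zero_vec(1) zero_neq_one)
      then show ?thesis using pos[of "unit_vec n i"] i carr by simp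
    qed
    have g_sum: "g I = (\<Sum>i\<in>I. ln (M $$ (i, i)))" if "I \<subseteq> {..<n}" for I
      unfolding g_def by (rule log_det_principal_submatrix_diagonal[OF carr diag that]) (use M_pos that in auto)
    \<comment> \<open>With \<open>J = {}\<close> the exchange bound compares singletons, that is,
      the logarithms of two diagonal entries.\<close>
    have a: "\<bar>ln (M $$ (i, i)) - ln (M $$ (j, j))\<bar> \<le> L" if "i \<in> {..<n}" "j \<in> {..<n}" for i j
      using swap_boundedD[OF swap, of "{}" i j] g_sum[of "{i}"] g_sum[of "{j}"] that by simp
    have "(\<Sum>I\<in>K. (g I - average K g)\<^sup>2)
        = (\<Sum>I\<in>K. ((\<Sum>i\<in>I. ln (M $$ (i, i))) - average K (\<lambda>I. \<Sum>i\<in>I. ln (M $$ (i, i))))\<^sup>2)"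
      using g_sum by (simp add: average_def K_def)
    also have "\<dots> \<le> real (n choose k) * (real k * real (n - k) / real (n - 1) * (L\<^sup>2 / 4))"
      using k_subsets_square_deviation_additive_le[of "{..<n}" k "\<lambda>i. ln (M $$ (i, i))" L] k1 kn n2 a
      by (simp add: K_def del: of_nat_diff)
    finally have "V \<le> real k * real (n - k) / real (n - 1) * (L\<^sup>2 / 4)"
      using choose_pos by (simp add: V_def pos_divide_le_eq mult_ac del: of_nat_diff)
    then have "sqrt (V / real q) \<le> 1 / 2 * sqrt (real k * real (n - k) / real (n - 1) / real q) * ln \<kappa>"
      by (rule sqrt_variance_bound[OF _ L0 L\<kappa>]) (use q in auto)
    then show ?thesis by (simp add: SY mult.commute del: of_nat_diff)
  qed
  show ?thesis using Sh first_bound min_bound diag_bound by blast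
qed

end
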